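(* Let $b$ be the number of data items in one cache block and assume that both the image and the kernel are laid out in row-major order. Then the data movement complexity (DMC) $D^{(b)}_{conv}(n,k)$ of spatial convolution of an $n\times n$ image with a $k\times k$ kernel, quantified with cache blocks instead of data items, satisfies $$D^{(b)}_{conv}(n,k)\sim\frac{1}{\sqrt b}\bigl(2\sqrt2\,n^2k^3+n^{2.5}k^{1.5}\bigr).$$
   Context: Spatial convolution (naive algorithm). The input is an $n\times n$ image $I$ (already padded with zeros if needed) and a $k\times k$ kernel $K$. For each of the $n-k+1$ values of $i$ starting from $0$ (outermost loop), for each of the $n-k+1$ values of $j$ starting from $0$: set $\mathrm{sum}=0$; for $y=0,\dots,k-1$, for $x=0,\dots,k-1$: $\mathrm{sum}\mathrel{+}=K[y][x]\cdot I[i+y][j+x]$; then set $R[i][j]=\mathrm{sum}$. Data movement complexity. For an access to a datum, the (LRU) reuse distance is the amount of distinct data accessed since the previous access to the same datum, the datum itself included; the cost of the access is the square root of its reuse distance; the DMC is the sum of the costs of all accesses (only reuses are charged). Ordinarily the amount of data is measured by the number of distinct data items. Memory systems cache blocks rather than individual data; "quantified with cache blocks instead of data items" means that the amount of data is measured in cache blocks, each holding $b$ data items, without accounting for the size of a block. Notation. $\sim$ is the asymptotic notation that is identical to big-O notation except that it retains the coefficients of the primary terms.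
   Formalization: The asymptotic relation is taken as k tends to infinity with k/n tending to 0; without this the stated coefficients fail, e.g. for k = n (a single window, only the running sum is reused), for k proportional to n, or for fixed k. *)

theory Defs
  imports Complex_Main "HOL-Library.Landau_Symbols"
begin

text \<open>
  An access trace is the list of the data accessed, in program order.  The parameter
  \<open>amount\<close> says how the amount of data in a set of data is measured: \<open>card\<close> counts
  data items, \<open>cache_blocks b addr\<close> below counts cache blocks.
\<close>

definition is_reuse :: "'a list \<Rightarrow> nat \<Rightarrow> bool" where
  "is_reuse tr t \<longleftrightarrow> t < length tr \<and> (\<exists>s<t. tr ! s = tr ! t)"

definition previous_access :: "'a list \<Rightarrow> nat \<Rightarrow> nat" where
  "previous_access tr t = Max {s. s < t \<and> tr ! s = tr ! t}"

definition data_since_previous :: "'a list \<Rightarrow> nat \<Rightarrow> 'a set" where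
  "data_since_previous tr t = (\<lambda>s. tr ! s) ` {previous_access tr t..t}"

definition reuse_distance :: "('a set \<Rightarrow> nat) \<Rightarrow> 'a list \<Rightarrow> nat \<Rightarrow> nat" where
  "reuse_distance amount tr t = amount (data_since_previous tr t)"

definition dmc :: "('a set \<Rightarrow> nat) \<Rightarrow> 'a list \<Rightarrow> real" where
  "dmc amount tr = (\<Sum>t | is_reuse tr t. sqrt (real (reuse_distance amount tr t)))"

text \<open>
  \<open>addr\<close> places every datum in a linear memory; cache block \<open>m\<close> consists of the
  addresses \<open>m * b, \<dots>, m * b + (b - 1)\<close>.  Only the measure of an amount of data depends
  on blocks: a reuse is still a reuse of the same datum, not of the same block.
\<close>

definition cache_blocks :: "nat \<Rightarrow> ('a \<Rightarrow> nat) \<Rightarrow> 'a set \<Rightarrow> nat" where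
  "cache_blocks b addr A = card ((\<lambda>d. addr d div b) ` A)"

text \<open>The data of the convolution: image, kernel and result elements, and the scalar \<open>sum\<close>.\<close>

datatype datum = Pixel nat nat | Kernel nat nat | Result nat nat | Acc

text \<open>
  The accumulation \<open>sum += K[y][x] * I[i+y][j+x]\<close> reads the two operands, then reads and
  writes \<open>sum\<close>.  There are \<open>n - k + 1\<close> values of \<open>i\<close> and of \<open>j\<close>, for \<open>k \<le> n\<close>.
\<close>

definition conv_trace :: "nat \<Rightarrow> nat \<Rightarrow> datum list" where
  "conv_trace n k =
     concat (map (\<lambda>i. concat (map (\<lambda>j.
       [Acc] @
       concat (map (\<lambda>y. concat (map (\<lambda>x.
         [Kernel y x, Pixel (i + y) (j + x), Acc, Acc])
         [0..<k])) [0..<k]) @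
       [Acc, Result i j])
     [0..<n + 1 - k])) [0..<n + 1 - k])"

definition row_major :: "(datum \<Rightarrow> nat) \<Rightarrow> (nat \<Rightarrow> nat \<Rightarrow> datum) \<Rightarrow> nat \<Rightarrow> bool" where
  "row_major addr arr m \<longleftrightarrow>
     (\<exists>base. \<forall>r<m. \<forall>c<m. addr (arr r c) = base + r * m + c)"

text \<open>
  Image and kernel are row-major, starting at arbitrary (not necessarily block-aligned)
  addresses; distinct data have distinct addresses.  The placement of the result and of
  the scalar is otherwise free.
\<close>

definition conv_layout :: "nat \<Rightarrow> nat \<Rightarrow> (datum \<Rightarrow> nat) \<Rightarrow> bool" where
  "conv_layout n k addr \<longleftrightarrow>
     inj_on addr (set (conv_trace n k)) \<and>
     row_major addr Pixel n \<and> row_major addr Kernel k"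

definition conv_block_dmc :: "nat \<Rightarrow> (datum \<Rightarrow> nat) \<Rightarrow> nat \<Rightarrow> nat \<Rightarrow> real" where
  "conv_block_dmc b addr n k = dmc (cache_blocks b addr) (conv_trace n k)"

text \<open>
  The limit in which the two-variable asymptotics is taken: pairs \<open>(n, k)\<close> with
  \<open>k \<rightarrow> \<infinity>\<close> and \<open>k / n \<rightarrow> 0\<close> (hence \<open>n \<rightarrow> \<infinity>\<close>), and no other relation between \<open>n\<close> and \<open>k\<close>.
  Both conditions are needed for the leading terms to be those of the theorem.  For
  example, the number of accesses to the kernel is \<open>(n - k + 1)^2 * k^2\<close>, which is \<open>n^2 * k^2\<close>
  to leading order only if \<open>k / n \<rightarrow> 0\<close>; a row of \<open>k\<close> consecutive items occupies \<open>k / b\<close> blocks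
  to leading order only if \<open>k \<rightarrow> \<infinity>\<close>.
\<close>

definition conv_limit :: "(nat \<times> nat) filter" where
  "conv_limit =
     inf (filtercomap (\<lambda>(n, k). k) at_top)
         (filtercomap (\<lambda>(n, k). real n / real k) at_top)"

end

theory Submission
  imports Defs
begin

text \<open>
  Within a row of output elements, two successive windows share all but one column.  Hence a
  kernel element, and a pixel that was already in the previous window, is reused after
  about \<open>k\<^sup>2\<close> kernel elements and \<open>k\<^sup>2\<close> pixels, that is, after \<open>2 * k\<^sup>2 / b\<close> blocks; there are
  about \<open>2 * n\<^sup>2 * k\<^sup>2\<close> such accesses.  A pixel of the new rightmost column was last used while the
  previous output row was computed, about \<open>n * k\<close> pixels ago; there are about \<open>n\<^sup>2 * k\<close> such
  accesses.  Everything else is of lower order.  Only estimates of the reuse distances are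
  needed: from below, a set of \<open>m\<close> data occupies at least \<open>m / b\<close> blocks; from above, \<open>l\<close>
  consecutive addresses occupy at most \<open>l / b + 2\<close> blocks, and any earlier access to the
  same datum bounds the reuse distance.
\<close>

section \<open>Positions in concatenated lists and lexicographic order\<close>

lemma length_concat_upt:
  assumes "\<And>a. a < m \<Longrightarrow> length (g a) = p"
  shows "length (concat (map g [0..<m])) = m * p"
  using assms by (induction m) auto

lemma nth_concat_upt:
  assumes "\<And>a. a < m \<Longrightarrow> length (g a) = p" and "a < m" and "q < p"
  shows "concat (map g [0..<m]) ! (a * p + q) = g a ! q"
  using assms
proof (induction m)
  case (Suc m)
  have len: "length (concat (map g [0..<m])) = m * p"
    using Suc.prems(1) by (intro length_concat_upt) auto
  show ?case
  proof (cases "a = m")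
    case True
    with Suc.prems len show ?thesis by (simp add: nth_append)
  next
    case False
    with Suc.prems have "a < m" by simp
    have "Suc a * p \<le> m * p" using \<open>a < m\<close> by (intro mult_le_mono1) auto
    then have "a * p + q < m * p" using Suc.prems by simp
    with Suc len \<open>a < m\<close> show ?thesis by (simp add: nth_append)
  qed
qed simp

text \<open>\<open>a\<close> and \<open>b\<close> are the digits of a two-digit number in base
  \<open>m\<close>. Applied level by level, this turns the comparison of times in the trace into the
  comparison of loop indices.\<close>

lemma lex_less_iff:
  fixes a b a' b' m :: nat
  assumes "b < m" "b' < m"
  shows "a * m + b < a' * m + b' \<longleftrightarrow> a < a' \<or> a = a' \<and> b < b'"
proof -
  have *: "c * m + d < c' * m + d'" if "c < c'" "d < m" for c d c' d'
  proof -
    have "Suc c * m \<le> c' * m" using that by (intro mult_le_mono1) auto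
    with that show ?thesis by simp
  qed
  show ?thesis
    using *[of a a' b b'] *[of a' a b' b] assms by (cases a a' rule: linorder_cases) auto
qed

section \<open>Estimates for reuse distances and for numbers of cache blocks\<close>

text \<open>The latest earlier access is not before \<open>s\<close>, so the data since then lie in
  the stretch from \<open>s\<close> on. As \<open>amount\<close> is arbitrary, a bound on all
  subsets of \<open>A\<close> takes the place of monotonicity.\<close>

lemma reuse_distance_le:
  assumes "s < t" "tr ! s = tr ! t"
    and sub: "(!) tr ` {s..t} \<subseteq> A"
    and mono: "\<And>B. B \<subseteq> A \<Longrightarrow> amount B \<le> c"
  shows "reuse_distance amount tr t \<le> c"
proof -
  have "s \<le> previous_access tr t"
    unfolding previous_access_def using assms by (intro Max_ge) auto
  then have "data_since_previous tr t \<subseteq> (!) tr ` {s..t}"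
    unfolding data_since_previous_def by auto
  with sub mono show ?thesis unfolding reuse_distance_def by blast
qed

text \<open>Counterpart for lower bounds: \<open>s0\<close> is any time that bounds the earlier
  accesses from above. It may be the latest access itself or, as in \<open>vertical_reuse\<close>,
  the end of a loop body.\<close>

lemma data_since_previous_superset:
  assumes "is_reuse tr t" and "\<And>s. s < t \<Longrightarrow> tr ! s = tr ! t \<Longrightarrow> s \<le> s0"
  shows "(!) tr ` {s0..t} \<subseteq> data_since_previous tr t"
proof -
  have "previous_access tr t \<le> s0"
    unfolding previous_access_def
    using assms by (intro Max.boundedI) (auto simp: is_reuse_def)
  then show ?thesis unfolding data_since_previous_def by auto
qed

lemma cache_blocks_le_card: "finite A \<Longrightarrow> cache_blocks b addr A \<le> card A"
  unfolding cache_blocks_def by (rule card_image_le)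

lemma cache_blocks_mono: "finite A \<Longrightarrow> B \<subseteq> A \<Longrightarrow> cache_blocks b addr B \<le> cache_blocks b addr A"
  unfolding cache_blocks_def by (intro card_mono) auto

lemma cache_blocks_Un_le:
  "cache_blocks b addr (A \<union> B) \<le> cache_blocks b addr A + cache_blocks b addr B"
  unfolding cache_blocks_def image_Un by (rule card_Un_le)

lemma cache_blocks_UN_le:
  "finite I \<Longrightarrow> cache_blocks b addr (\<Union>i\<in>I. A i) \<le> (\<Sum>i\<in>I. cache_blocks b addr (A i))"
  unfolding cache_blocks_def image_UN by (rule card_UN_le)

text \<open>The 2 is the rounding loss at unaligned ends: one block from counting a closed interval
  of block numbers, one from rounding down \<open>a / b\<close>.\<close>

lemma cache_blocks_run_le:
  assumes "b \<ge> 1" "addr ` A \<subseteq> {a..<a + l}"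
  shows "real (cache_blocks b addr A) \<le> real l / real b + 2"
proof -
  have "(\<lambda>d. addr d div b) ` A \<subseteq> {a div b..(a + l) div b}"
    using assms by (force intro!: div_le_mono)
  then have "cache_blocks b addr A \<le> card {a div b..(a + l) div b}"
    unfolding cache_blocks_def by (intro card_mono) auto
  then have "real (cache_blocks b addr A) \<le> real ((a + l) div b) + 1 - real (a div b)"
    using div_le_mono[of a "a + l" b] by auto
  moreover have "real ((a + l) div b) \<le> real (a + l) / real b"
    by (rule of_nat_div_le_of_nat)
  moreover have "real a / real b - 1 \<le> real (a div b)"
  proof -
    have "a \<le> a div b * b + b"
      using assms(1) mod_less_divisor[of b a] div_mult_mod_eq[of a b] by linarith
    then have "real a \<le> (real (a div b) + 1) * real b"
      by (metis distrib_right mult_1 of_nat_1 of_nat_add of_nat_le_iff of_nat_mult)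
    then show ?thesis using assms(1) by (simp add: divide_le_eq diff_le_eq)
  qed
  ultimately show ?thesis by (simp add: add_divide_distrib)
qed

text \<open>A block holds only \<open>b\<close> addresses and distinct data have distinct addresses,
  so this bound holds for every placement of the data.\<close>

lemma cache_blocks_ge:
  assumes "b \<ge> 1" "finite A" "inj_on addr A"
  shows "real (card A) / real b \<le> real (cache_blocks b addr A)"
proof -
  have "addr ` A \<subseteq> (\<Union>m\<in>(\<lambda>d. addr d div b) ` A. {m * b..<m * b + b})"
  proof
    fix a assume a: "a \<in> addr ` A"
    have "a div b * b \<le> a" "a < a div b * b + b"
      using assms(1) mod_less_divisor[of b a] div_mult_mod_eq[of a b] by linarith+
    then have "a \<in> {a div b * b..<a div b * b + b}" by simp
    with a show "a \<in> (\<Union>m\<in>(\<lambda>d. addr d div b) ` A. {m * b..<m * b + b})" by blast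
  qed
  then have "card (addr ` A) \<le> card (\<Union>m\<in>(\<lambda>d. addr d div b) ` A. {m * b..<m * b + b})"
    using assms by (intro card_mono) auto
  also have "\<dots> \<le> (\<Sum>m\<in>(\<lambda>d. addr d div b) ` A. card {m * b..<m * b + b})"
    using assms by (intro card_UN_le) auto
  also have "\<dots> = cache_blocks b addr A * b" by (simp add: cache_blocks_def)
  finally have "card A \<le> cache_blocks b addr A * b"
    using assms by (simp add: card_image)
  then have "real (card A) \<le> real (cache_blocks b addr A) * real b"
    by (metis of_nat_le_iff of_nat_mult)
  then show ?thesis using assms by (simp add: divide_le_eq)
qed

section \<open>The convolution trace: which datum is accessed at which position\<close>

locale convolution =
  fixes n k :: nat
  assumes k_pos: "1 \<le> k" and k_le: "k \<le> n"
begin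

definition N :: nat where "N = n + 1 - k"
text \<open>Length of the body for one output element: four accesses in each of the
  \<open>k * k\<close> inner steps, and three for initialising and reading the sum and storing the
  result.\<close>

definition P :: nat where "P = k * (k * 4) + 3"

abbreviation tr :: "datum list" where "tr \<equiv> conv_trace n k"

text \<open>The time of the access with offset \<open>q\<close> in the body for output element (i,
  j).\<close>

definition pos :: "nat \<Rightarrow> nat \<Rightarrow> nat \<Rightarrow> nat" where
  "pos i j q = (i * N + j) * P + q"

text \<open>The offset in a body of access \<open>c\<close> of inner step (y, x):
  \<open>c = 0\<close> is the kernel element, \<open>c = 1\<close> the pixel, 2 and 3 are the sum.
  The leading 1 skips the initialisation of the sum.\<close>

definition step :: "nat \<Rightarrow> nat \<Rightarrow> nat \<Rightarrow> nat" where
  "step y x c = 1 + (y * (k * 4) + (x * 4 + c))"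

definition steps :: "nat \<Rightarrow> nat \<Rightarrow> datum list" where
  "steps i j = concat (map (\<lambda>y. concat (map (\<lambda>x.
         [Kernel y x, Pixel (i + y) (j + x), Acc, Acc]) [0..<k])) [0..<k])"

lemma length_steps: "length (steps i j) = k * (k * 4)"
  unfolding steps_def by (intro length_concat_upt) auto

lemma nth_steps:
  assumes "y < k" "x < k" "c < 4"
  shows "steps i j ! (y * (k * 4) + (x * 4 + c)) = [Kernel y x, Pixel (i + y) (j + x), Acc, Acc] ! c"
proof -
  have "x * 4 + c < k * 4" using assms by simp
  with assms show ?thesis unfolding steps_def
    by (subst nth_concat_upt[where p = "k * 4"])
      (auto intro!: length_concat_upt simp: nth_concat_upt)
qed

lemma tr_eq: "tr = concat (map (\<lambda>i. concat (map (\<lambda>j. [Acc] @ steps i j @ [Acc, Result i j])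
     [0..<N])) [0..<N])"
  by (simp add: conv_trace_def steps_def N_def)

lemma length_body: "length ([Acc] @ steps i j @ [Acc, Result i j]) = P"
  by (simp add: length_steps P_def)

lemma length_row: "length (concat (map (\<lambda>j. [Acc] @ steps i j @ [Acc, Result i j]) [0..<N])) = N * P"
  by (intro length_concat_upt length_body)

lemma length_tr: "length tr = N * (N * P)"
  unfolding tr_eq by (intro length_concat_upt length_row)

lemma nth_pos:
  assumes "i < N" "j < N" "q < P"
  shows "tr ! pos i j q = ([Acc] @ steps i j @ [Acc, Result i j]) ! q"
proof -
  have "Suc j * P \<le> N * P" using assms by (intro mult_le_mono1) auto
  then have lt: "j * P + q < N * P" using assms by simp
  have "pos i j q = i * (N * P) + (j * P + q)" by (simp add: pos_def algebra_simps)
  then have "tr ! pos i j q = concat (map (\<lambda>j. [Acc] @ steps i j @ [Acc, Result i j]) [0..<N]) ! (j * P + q)"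
    unfolding tr_eq using assms lt by (simp only: nth_concat_upt[OF length_row])
  also have "\<dots> = ([Acc] @ steps i j @ [Acc, Result i j]) ! q"
    using assms by (simp only: nth_concat_upt[OF length_body])
  finally show ?thesis .
qed

lemma step_less:
  assumes "y < k" "x < k" "c < 4"
  shows "step y x c < k * (k * 4) + 1"
proof -
  have "Suc y * (k * 4) \<le> k * (k * 4)" using assms by (intro mult_le_mono1) auto
  with assms show ?thesis by (simp add: step_def)
qed

lemma step_less_P: "y < k \<Longrightarrow> x < k \<Longrightarrow> c < 4 \<Longrightarrow> step y x c < P"
  using step_less[of y x c] by (simp add: P_def)

lemma tr_step:
  assumes "i < N" "j < N" "y < k" "x < k" "c < 4"
  shows "tr ! pos i j (step y x c) = [Kernel y x, Pixel (i + y) (j + x), Acc, Acc] ! c"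
proof -
  have "y * (k * 4) + (x * 4 + c) < k * (k * 4)"
    using step_less[OF assms(3-5)] by (simp add: step_def)
  then show ?thesis
    using assms step_less_P[OF assms(3-5)] nth_steps[OF assms(3-5), of i j]
    by (simp add: nth_pos step_def nth_append length_steps)
qed

lemma tr_kernel:
  "\<lbrakk>i < N; j < N; y < k; x < k\<rbrakk> \<Longrightarrow> tr ! pos i j (step y x 0) = Kernel y x"
  by (simp add: tr_step)

lemma tr_pixel:
  "\<lbrakk>i < N; j < N; y < k; x < k\<rbrakk> \<Longrightarrow> tr ! pos i j (step y x 1) = Pixel (i + y) (j + x)"
  by (simp add: tr_step)

lemma tr_first: "i < N \<Longrightarrow> j < N \<Longrightarrow> tr ! pos i j 0 = Acc"
  by (subst nth_pos) (auto simp: P_def)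

lemma tr_last_Acc: "i < N \<Longrightarrow> j < N \<Longrightarrow> tr ! pos i j (k * (k * 4) + 1) = Acc"
  by (subst nth_pos) (auto simp: P_def nth_append length_steps)

lemma tr_result: "i < N \<Longrightarrow> j < N \<Longrightarrow> tr ! pos i j (k * (k * 4) + 2) = Result i j"
  by (subst nth_pos) (auto simp: P_def nth_append length_steps)

lemma pos_less_iff:
  assumes "j < N" "j' < N" "q < P" "q' < P"
  shows "pos i j q < pos i' j' q' \<longleftrightarrow> i < i' \<or> i = i' \<and> (j < j' \<or> j = j' \<and> q < q')"
proof -
  have inj: "i * N + j = i' * N + j' \<longleftrightarrow> i = i' \<and> j = j'"
    using lex_less_iff[OF assms(1,2), of i i'] lex_less_iff[OF assms(2,1), of i' i]
    by (cases i i' rule: linorder_cases) auto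
  show ?thesis unfolding pos_def
    using lex_less_iff[OF assms(3,4)] lex_less_iff[OF assms(1,2)] inj by auto
qed

lemma pos_eq_iff:
  assumes "j < N" "j' < N" "q < P" "q' < P"
  shows "pos i j q = pos i' j' q' \<longleftrightarrow> i = i' \<and> j = j' \<and> q = q'"
  using pos_less_iff[OF assms, of i i'] pos_less_iff[OF assms(2,1,4,3), of i' i]
  by (metis linorder_less_linear less_irrefl)

lemma step_less_iff:
  assumes "x < k" "x' < k" "c < 4" "c' < 4"
  shows "step y x c < step y' x' c' \<longleftrightarrow> y < y' \<or> y = y' \<and> (x < x' \<or> x = x' \<and> c < c')"
proof -
  have "x * 4 + c < k * 4" "x' * 4 + c' < k * 4" using assms by auto
  from lex_less_iff[OF this] lex_less_iff[OF assms(3,4)] show ?thesis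
    unfolding step_def using assms by auto
qed

lemma step_eq_iff:
  assumes "x < k" "x' < k" "c < 4" "c' < 4"
  shows "step y x c = step y' x' c' \<longleftrightarrow> y = y' \<and> x = x' \<and> c = c'"
  using step_less_iff[OF assms, of y y'] step_less_iff[OF assms(2,1,4,3), of y' y]
  by (metis linorder_less_linear less_irrefl)

lemma pos_less_length:
  assumes "i < N" "j < N" "q < P"
  shows "pos i j q < length tr"
proof -
  have "N > 0" "P > 0" using assms by auto
  then have "pos i j q < pos N 0 0" using assms by (simp add: pos_less_iff)
  then show ?thesis by (simp add: pos_def length_tr)
qed

lemma pos_cases:
  assumes "t < length tr"
  obtains i j q where "i < N" "j < N" "q < P" "t = pos i j q"
proof
  have t: "t < N * N * P" using assms by (simp add: length_tr)
  then have "t div P < N * N" by (simp add: less_mult_imp_div_less)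
  then show "t div P div N < N" by (simp add: less_mult_imp_div_less)
  show "t div P mod N < N" "t mod P < P" using t by (auto intro!: mod_less_divisor gr0I)
  show "t = pos (t div P div N) (t div P mod N) (t mod P)"
    unfolding pos_def by (simp only: div_mult_mod_eq)
qed

lemma phase_cases:
  assumes "q < P"
  obtains "q = 0" | y x c where "y < k" "x < k" "c < 4" "q = step y x c"
  | "q = k * (k * 4) + 1" | "q = k * (k * 4) + 2"
proof (cases "q = 0 \<or> q > k * (k * 4)")
  case True
  with assms that show thesis unfolding P_def by fastforce
next
  case False
  define e where "e = q - 1"
  have e: "q = 1 + e" "e < k * (k * 4)" using False by (auto simp: e_def)
  show thesis
  proof (rule that(2))
    show "e div (k * 4) < k" using e by (intro less_mult_imp_div_less)
    show "e mod (k * 4) div 4 < k" using k_pos by (intro less_mult_imp_div_less mod_less_divisor) auto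
    show "e mod (k * 4) mod 4 < 4" by simp
    show "q = step (e div (k * 4)) (e mod (k * 4) div 4) (e mod (k * 4) mod 4)"
      by (simp only: step_def e div_mult_mod_eq)
  qed
qed

text \<open>Converse of \<open>tr_kernel\<close>. Enumerating all accesses to a datum is what makes
  it possible to identify the latest earlier one.\<close>

lemma kernel_positions:
  assumes "t < length tr" "tr ! t = Kernel y x"
  obtains i j where "i < N" "j < N" "y < k" "x < k" "t = pos i j (step y x 0)"
proof -
  from assms(1) obtain i j q where t: "i < N" "j < N" "q < P" "t = pos i j q" by (rule pos_cases)
  from \<open>q < P\<close> show thesis
  proof (cases rule: phase_cases)
    case (2 y' x' c)
    with assms t have "[Kernel y' x', Pixel (i + y') (j + x'), Acc, Acc] ! c = Kernel y x"
      by (simp add: tr_step)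
    with \<open>c < 4\<close> have "y' = y" "x' = x" "c = 0" by (auto simp: less_Suc_eq numeral_eq_Suc)
    with 2 t that show thesis by blast
  qed (use assms t in \<open>auto simp: tr_first tr_last_Acc[simplified] tr_result[simplified]\<close>)
qed

lemma pixel_positions:
  assumes "t < length tr" "tr ! t = Pixel r c"
  obtains i j y x where "i < N" "j < N" "y < k" "x < k" "i + y = r" "j + x = c"
    "t = pos i j (step y x 1)"
proof -
  from assms(1) obtain i j q where t: "i < N" "j < N" "q < P" "t = pos i j q" by (rule pos_cases)
  from \<open>q < P\<close> show thesis
  proof (cases rule: phase_cases)
    case (2 y' x' d)
    with assms t have "[Kernel y' x', Pixel (i + y') (j + x'), Acc, Acc] ! d = Pixel r c"
      by (simp add: tr_step)
    with \<open>d < 4\<close> have "i + y' = r" "j + x' = c" "d = 1"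
      by (auto simp: less_Suc_eq numeral_eq_Suc)
    with 2 t that show thesis by blast
  qed (use assms t in \<open>auto simp: tr_first tr_last_Acc[simplified] tr_result[simplified]\<close>)
qed

text \<open>Each result element is stored once, so it never causes a reuse.\<close>

lemma result_position:
  assumes "t < length tr" "tr ! t = Result i j"
  shows "t = pos i j (k * (k * 4) + 2)"
proof -
  from assms(1) obtain i' j' q where t: "i' < N" "j' < N" "q < P" "t = pos i' j' q"
    by (rule pos_cases)
  from \<open>q < P\<close> show ?thesis
  proof (cases rule: phase_cases)
    case (2 y' x' d)
    with assms t have "[Kernel y' x', Pixel (i' + y') (j' + x'), Acc, Acc] ! d = Result i j"
      by (simp add: tr_step)
    with \<open>d < 4\<close> show ?thesis by (auto simp: less_Suc_eq numeral_eq_Suc)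
  qed (use assms t in \<open>auto simp: tr_first tr_last_Acc[simplified] tr_result[simplified]\<close>)
qed

section \<open>Data touched in a stretch of the trace\<close>

definition kernel_data :: "datum set" where
  "kernel_data = {Kernel y x | y x. y < k \<and> x < k}"

definition pixels :: "nat set \<Rightarrow> nat set \<Rightarrow> datum set" where
  "pixels R C = (\<lambda>(r, c). Pixel r c) ` (R \<times> C)"

lemma Pixel_in_pixels [simp]: "Pixel r c \<in> pixels R C \<longleftrightarrow> r \<in> R \<and> c \<in> C"
  by (auto simp: pixels_def)

lemma finite_kernel_data [simp]: "finite kernel_data"
proof -
  have "kernel_data = (\<lambda>(y, x). Kernel y x) ` ({..<k} \<times> {..<k})" by (auto simp: kernel_data_def)
  then show ?thesis by simp
qed

lemma finite_pixels [simp]: "finite R \<Longrightarrow> finite C \<Longrightarrow> finite (pixels R C)"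
  by (simp add: pixels_def)

lemma card_pixels: "card (pixels R C) = card R * card C"
  unfolding pixels_def by (subst card_image) (auto simp: inj_on_def card_cartesian_product)

lemma tr_window:
  assumes "i < N" "j < N" "q < P"
  shows "tr ! pos i j q \<in> {Acc, Result i j} \<union> kernel_data
    \<union> pixels {i..<i + k} {j..<j + k}"
  using assms(3)
proof (cases rule: phase_cases)
  case (2 y x c)
  then show ?thesis using assms
    by (auto simp: tr_step kernel_data_def less_Suc_eq numeral_eq_Suc)
qed (use assms in \<open>auto simp: tr_first tr_last_Acc[simplified] tr_result[simplified]\<close>)

text \<open>The stretch begins no earlier than the preceding body of the same output row, so it
  meets two bodies, whose windows together form \<open>k\<close> by \<open>k + 1\<close>
  pixels.\<close>

lemma data_horizontal:
  assumes "i < N" "j < N" "q < P" "0 < j" "pos i (j - 1) 0 \<le> s"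
  shows "(!) tr ` {s..pos i j q} \<subseteq> {Acc, Result i (j - 1), Result i j} \<union> kernel_data
    \<union> pixels {i..<i + k} {j - 1..<j + k}"
proof
  fix d assume "d \<in> (!) tr ` {s..pos i j q}"
  then obtain u where u: "s \<le> u" "u \<le> pos i j q" and d: "d = tr ! u" by auto
  have "u < length tr" using u pos_less_length[OF assms(1-3)] by simp
  then obtain i' j' q' where u': "i' < N" "j' < N" "q' < P" "u = pos i' j' q'" by (rule pos_cases)
  have "\<not> pos i' j' q' < pos i (j - 1) 0" "\<not> pos i j q < pos i' j' q'"
    using u u' assms by auto
  then have "i' = i" "j' = j \<or> j' = j - 1"
    using assms u' by (auto simp: pos_less_iff)
  moreover from this have "pixels {i'..<i' + k} {j'..<j' + k} \<subseteq> pixels {i..<i + k} {j - 1..<j + k}"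
    unfolding pixels_def by (intro image_mono Sigma_mono) auto
  ultimately show "d \<in> {Acc, Result i (j - 1), Result i j} \<union> kernel_data
    \<union> pixels {i..<i + k} {j - 1..<j + k}"
    using tr_window[OF u'(1-3)] unfolding d u'(4) by blast
qed

text \<open>The stretch meets only output rows \<open>i - 1\<close> and \<open>i\<close>, whose
  windows lie in \<open>k + 1\<close> image rows. For \<open>i = 0\<close> truncated subtraction
  makes the two rows coincide, so the first row is covered as well.\<close>

lemma data_vertical:
  assumes "i < N" "j < N" "q < P" "pos (i - 1) 0 0 \<le> s"
  shows "(!) tr ` {s..pos i j q} \<subseteq> {Acc} \<union> (\<Union>i'\<in>{i - 1, i}. Result i' ` {..<N}) \<union> kernel_data
    \<union> pixels {i - 1..<i + k} {..<n}"
proof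
  fix d assume "d \<in> (!) tr ` {s..pos i j q}"
  then obtain u where u: "s \<le> u" "u \<le> pos i j q" and d: "d = tr ! u" by auto
  have "u < length tr" using u pos_less_length[OF assms(1-3)] by simp
  then obtain i' j' q' where u': "i' < N" "j' < N" "q' < P" "u = pos i' j' q'" by (rule pos_cases)
  have "\<not> pos i' j' q' < pos (i - 1) 0 0" "\<not> pos i j q < pos i' j' q'"
    using u u' assms by auto
  then have i': "i' = i \<or> i' = i - 1"
    using assms u' by (auto simp: pos_less_iff)
  have "{j'..<j' + k} \<subseteq> {..<n}" using u' k_le by (auto simp: N_def)
  moreover have "{i'..<i' + k} \<subseteq> {i - 1..<i + k}" using i' by auto
  ultimately have "pixels {i'..<i' + k} {j'..<j' + k}
      \<subseteq> pixels {i - 1..<i + k} {..<n}"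
    unfolding pixels_def by (intro image_mono Sigma_mono)
  moreover have "Result i' j' \<in> (\<Union>i'\<in>{i - 1, i}. Result i' ` {..<N})" using i' u' by auto
  ultimately show "d \<in> {Acc} \<union> (\<Union>i'\<in>{i - 1, i}. Result i' ` {..<N}) \<union> kernel_data
    \<union> pixels {i - 1..<i + k} {..<n}"
    using tr_window[OF u'(1-3)] unfolding d u'(4) by blast
qed


section \<open>Earlier accesses to the same datum\<close>

text \<open>Only the two operands of an inner step, or the store of a result, separate successive
  accesses to the sum; hence its reuses have bounded cost.\<close>

lemma reuse_Acc:
  assumes "is_reuse tr t" "tr ! t = Acc"
  shows "\<exists>s. s < t \<and> t \<le> s + 3 \<and> tr ! s = Acc"
proof -
  obtain s where s: "s < t" "tr ! s = tr ! t" and "t < length tr"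
    using assms(1) by (auto simp: is_reuse_def)
  from this(3) obtain i j q where t: "i < N" "j < N" "q < P" "t = pos i j q" by (rule pos_cases)
  have prev: ?thesis if "tr ! u = Acc" "u < t" "t \<le> u + 3" for u using that by blast
  from \<open>q < P\<close> show ?thesis
  proof (cases rule: phase_cases)
    case 1
    show ?thesis
    proof (cases "j = 0")
      case False
      then show ?thesis using t 1 prev[of "pos i (j - 1) (k * (k * 4) + 1)"] tr_last_Acc[of i "j - 1"]
        by (cases j) (auto simp: pos_def P_def algebra_simps)
    next
      case True
      show ?thesis
      proof (cases "i = 0")
        case True
        with 1 \<open>j = 0\<close> t s show ?thesis by (simp add: pos_def)
      next
        case False
        \<comment> \<open>The body before the first one of row \<open>i\<close> is the last one of
          row \<open>i - 1\<close>.\<close>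
        obtain M where M: "N = Suc M" using t by (cases N) auto
        from False \<open>j = 0\<close> show ?thesis
          using t 1 prev[of "pos (i - 1) (N - 1) (k * (k * 4) + 1)"] tr_last_Acc[of "i - 1" "N - 1"] M
          by (cases i) (auto simp: pos_def P_def algebra_simps)
      qed
    qed
  next
    case (2 y x c)
    have step: ?thesis if "y' < k" "x' < k" "2 \<le> c'" "c' < 4"
      "step y' x' c' < q" "q \<le> step y' x' c' + 3" for y' x' c'
    proof (rule prev)
      show "tr ! pos i j (step y' x' c') = Acc"
        using that t tr_step[of i j y' x' c'] by (auto simp: less_Suc_eq numeral_eq_Suc)
    qed (use that t in \<open>auto simp: pos_def\<close>)
    have "c \<noteq> 0" "c \<noteq> 1" using assms(2) t 2 by (auto simp: tr_step intro!: gr0I)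
    then consider "c = 3" | "c = 2" using 2 by linarith
    then show ?thesis
    proof cases
      case 1
      then show ?thesis using step[of y x 2] 2 by (auto simp: step_def)
    next
      case c: 2
      consider "x > 0" | "x = 0" "y > 0" | "x = 0" "y = 0" by auto
      then show ?thesis
      proof cases
        case 1
        then show ?thesis using step[of y "x - 1" 3] 2 c by (cases x) (auto simp: step_def)
      next
        case e: 2
        then obtain y' where "y = Suc y'" by (cases y) auto
        \<comment> \<open>Before the first inner step of a kernel row comes the last inner step of
          the previous kernel row.\<close>
        then have "step y 0 2 = step (y - 1) (k - 1) 3 + 3"
          unfolding step_def using k_pos by simp
        with e show ?thesis using step[of "y - 1" "k - 1" 3] 2 c by simp
      next
        case 3
        then show ?thesis using prev[of "pos i j 0"] tr_first[of i j] t 2 c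
          by (auto simp: step_def pos_def)
      qed
    qed
  next
    case 3
    have "(k - 1) * (k * 4) + k * 4 = k * (k * 4)"
      using k_pos by (simp flip: mult_Suc add: add.commute)
    then have "q = step (k - 1) (k - 1) 3 + 1"
      unfolding 3 step_def using k_pos by (simp add: diff_mult_distrib)
    then show ?thesis using prev[of "pos i j (step (k - 1) (k - 1) 3)"]
        tr_step[of i j "k - 1" "k - 1" 3] t k_pos
      by (auto simp: pos_def)
  next
    case 4
    with assms(2) t show ?thesis by (simp add: tr_result[simplified])
  qed
qed

text \<open>Every body reads each kernel element exactly once, always at the same offset, so the
  latest earlier access is exactly one body back.\<close>

lemma kernel_reuse:
  assumes "i < N" "j < N" "y < k" "x < k" "0 < j"
  defines "t \<equiv> pos i j (step y x 0)" and "s0 \<equiv> pos i (j - 1) (step y x 0)"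
  shows "s0 < t" "tr ! s0 = tr ! t" "is_reuse tr t"
    and "\<And>s. s < t \<Longrightarrow> tr ! s = tr ! t \<Longrightarrow> s \<le> s0"
proof -
  have q: "step y x 0 < P" using assms by (intro step_less_P) auto
  show 1: "s0 < t" "tr ! s0 = tr ! t"
    unfolding s0_def t_def using assms q by (auto simp: pos_less_iff tr_kernel)
  have len: "t < length tr" unfolding t_def using assms q by (intro pos_less_length)
  with 1 show "is_reuse tr t" by (auto simp: is_reuse_def)
  fix s assume s: "s < t" "tr ! s = tr ! t"
  have "s < length tr" "tr ! s = Kernel y x" using s len assms by (auto simp: tr_kernel)
  then obtain i' j' where s': "i' < N" "j' < N" "s = pos i' j' (step y x 0)"
    by (rule kernel_positions)
  have "\<not> s0 < s" using s(1) s' assms q by (auto simp: pos_less_iff)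
  then show "s \<le> s0" by simp
qed

text \<open>Moving the window one column to the right moves a pixel from kernel column
  \<open>x + 1\<close> to \<open>x\<close>; the same pixel was therefore used in the preceding
  body.\<close>

lemma horizontal_reuse:
  assumes "i < N" "j < N" "y < k" "Suc x < k" "0 < j"
  defines "t \<equiv> pos i j (step y x 1)" and "s0 \<equiv> pos i (j - 1) (step y (Suc x) 1)"
  shows "s0 < t" "tr ! s0 = tr ! t" "is_reuse tr t"
    and "\<And>s. s < t \<Longrightarrow> tr ! s = tr ! t \<Longrightarrow> s \<le> s0"
proof -
  have q: "step y x 1 < P" "step y (Suc x) 1 < P" using assms by (auto intro!: step_less_P)
  have tr_t: "tr ! t = Pixel (i + y) (j + x)" unfolding t_def using assms by (subst tr_pixel) auto
  show 1: "s0 < t" unfolding s0_def t_def using assms q by (auto simp: pos_less_iff)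
  show 2: "tr ! s0 = tr ! t"
    unfolding tr_t unfolding s0_def using assms by (subst tr_pixel) auto
  have len: "t < length tr" unfolding t_def using assms q by (intro pos_less_length)
  with 1 2 show "is_reuse tr t" by (auto simp: is_reuse_def)
  fix s assume s: "s < t" "tr ! s = tr ! t"
  have "s < length tr" "tr ! s = Pixel (i + y) (j + x)" using s len tr_t by auto
  then obtain i' j' y' x' where s': "i' < N" "j' < N" "y' < k" "x' < k"
    "i' + y' = i + y" "j' + x' = j + x" "s = pos i' j' (step y' x' 1)"
    by (rule pixel_positions)
  have q': "step y' x' 1 < P" using s' by (intro step_less_P) auto
  show "s \<le> s0"
  proof (rule ccontr)
    assume "\<not> s \<le> s0"
    then have lt: "pos i (j - 1) (step y (Suc x) 1) < pos i' j' (step y' x' 1)"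
      "pos i' j' (step y' x' 1) < pos i j (step y x 1)"
      using s s' by (auto simp: s0_def t_def)
    \<comment> \<open>An access strictly between \<open>s0\<close> and \<open>t\<close> would belong
      to one of these two bodies; the coordinates of the pixel then fix its inner step, so it would
      be \<open>t\<close> or \<open>s0\<close> itself.\<close>
    then have i': "i' = i" and j': "j - 1 \<le> j'" "j' \<le> j" using s' assms q q'
      by (auto simp: pos_less_iff)
    then have y': "y' = y" using s' by simp
    from j' consider "j' = j" | "Suc j' = j" "j' = j - 1" by linarith
    then show False
    proof cases
      case 1
      then have "x' = x" using s' by simp
      with 1 i' y' lt show False by simp
    next
      case 2
      then have "x' = Suc x" using s' by simp
      with 2 i' y' lt show False by simp
    qed
  qed
qed

text \<open>A pixel of the rightmost window column is new to output row \<open>i\<close>, but unless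
  it lies in the last window row, row \<open>i - 1\<close> has used it. There it was last seen by
  output column \<open>j + k - 1\<close> at the latest, or \<open>N - 1\<close> if the row ends
  first; \<open>P - 1\<close> is the end of that body.\<close>

lemma vertical_reuse:
  assumes "i < N" "j < N" "Suc y < k" "0 < i"
  defines "t \<equiv> pos i j (step y (k - 1) 1)"
  shows "is_reuse tr t"
    and "\<And>s. s < t \<Longrightarrow> tr ! s = tr ! t \<Longrightarrow> s \<le> pos (i - 1) (min (j + k - 1) (N - 1)) (P - 1)"
proof -
  have q: "step y (k - 1) 1 < P" "step (Suc y) (k - 1) 1 < P" using assms by (auto intro!: step_less_P)
  have tr_t: "tr ! t = Pixel (i + y) (j + (k - 1))" unfolding t_def
    using assms by (subst tr_pixel) auto
  have len: "t < length tr" unfolding t_def using assms q by (intro pos_less_length)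
  have "pos (i - 1) j (step (Suc y) (k - 1) 1) < t"
    unfolding t_def using assms q by (auto simp: pos_less_iff)
  moreover have "tr ! pos (i - 1) j (step (Suc y) (k - 1) 1) = tr ! t"
    unfolding tr_t using assms by (subst tr_pixel) auto
  ultimately show "is_reuse tr t" using len by (auto simp: is_reuse_def)
  fix s assume s: "s < t" "tr ! s = tr ! t"
  have "s < length tr" "tr ! s = Pixel (i + y) (j + (k - 1))" using s len tr_t by auto
  then obtain i' j' y' x' where s': "i' < N" "j' < N" "y' < k" "x' < k"
    "i' + y' = i + y" "j' + x' = j + (k - 1)" "s = pos i' j' (step y' x' 1)"
    by (rule pixel_positions)
  have q': "step y' x' 1 < P" using s' by (intro step_less_P) auto
  have lt: "pos i' j' (step y' x' 1) < pos i j (step y (k - 1) 1)"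
    using s s' by (auto simp: t_def)
  \<comment> \<open>Within row \<open>i\<close>, image column \<open>j + k - 1\<close> first enters
    the window at output column \<open>j\<close>.\<close>
  have "i' < i"
  proof (rule ccontr)
    assume "\<not> i' < i"
    then have i': "i' = i" "j' \<le> j" using lt s' assms q q' by (auto simp: pos_less_iff)
    then have "y' = y" "x' = k - 1" "j' = j" using s' by auto
    with lt i' show False by simp
  qed
  moreover have "j' \<le> min (j + k - 1) (N - 1)" using s' by auto
  moreover have "step y' x' 1 \<le> P - 1" using q' by simp
  ultimately have "\<not> pos (i - 1) (min (j + k - 1) (N - 1)) (P - 1) < pos i' j' (step y' x' 1)"
    using s' assms q' by (subst pos_less_iff) (auto simp del: One_nat_def)
  then show "s \<le> pos (i - 1) (min (j + k - 1) (N - 1)) (P - 1)" using s' by simp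
qed

section \<open>Lower bounds for the amount of data between two uses\<close>

text \<open>From kernel row \<open>y\<close> of one body to kernel row \<open>y\<close> of the next,
  the later rows are completed in the first body and the earlier rows in the second. These are
  \<open>k - 1\<close> rows, each with \<open>k\<close> kernel elements and \<open>k\<close>
  pixels.\<close>

lemma card_horizontal_ge:
  assumes "i < N" "j < N" "y < k" "x < k" "0 < j" "c < 4"
    and s: "s < pos i (j - 1) (step (Suc y) 0 0)"
  shows "2 * k * (k - 1) \<le> card ((!) tr ` {s..pos i j (step y x c)})"
proof -
  let ?T = "(!) tr ` {s..pos i j (step y x c)}"
  let ?I = "({..<k} - {y}) \<times> {..<k}"
  \<comment> \<open>\<open>jj y'\<close> is the output column of the body in which kernel row
    \<open>y'\<close> is processed during the stretch.\<close>
  define jj where "jj y' = (if y' < y then j else j - 1)" for y'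
  let ?f = "\<lambda>(y', x'). Kernel y' x'" and ?g = "\<lambda>(y', x'). Pixel (i + y') (jj y' + x')"
  have in_range: "pos i (jj y') (step y' x' c') \<in> {s..pos i j (step y x c)}"
    if "y' < k" "y' \<noteq> y" "x' < k" "c' < 4" for y' x' c'
  proof -
    have q: "step y' x' c' < P" "step y x c < P" using that assms by (auto intro!: step_less_P)
    have jj: "jj y' < N" "jj y' \<le> j" using assms by (auto simp: jj_def)
    have "pos i (j - 1) (step (Suc y) 0 0) \<le> pos i (jj y') (step y' x' c')"
    proof (cases "y' < y")
      case True
      \<comment> \<open>For \<open>y = k - 1\<close> this offset is just past the inner steps, but
        still inside the body.\<close>
      have "step (Suc y) 0 0 \<le> k * (k * 4) + 1"
        using assms mult_le_mono1[of "Suc y" k "k * 4"] by (simp add: step_def)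
      then have "step (Suc y) 0 0 < P" by (simp add: P_def)
      with True show ?thesis using assms q jj
        by (intro less_imp_le) (auto simp: pos_less_iff jj_def)
    next
      case False
      then have "Suc y \<le> y'" using that by simp
      then have "step (Suc y) 0 0 \<le> step y' x' c'"
        using mult_le_mono1[of "Suc y" y' "k * 4"] by (simp add: step_def)
      with False show ?thesis by (simp add: jj_def pos_def)
    qed
    moreover have "pos i (jj y') (step y' x' c') < pos i j (step y x c)"
      using assms q jj that by (auto simp: pos_less_iff jj_def step_less_iff)
    ultimately show ?thesis using s by auto
  qed
  have "?f ` ?I \<union> ?g ` ?I \<subseteq> ?T"
  proof -
    have "Kernel y' x' \<in> ?T" "Pixel (i + y') (jj y' + x') \<in> ?T"
      if "y' < k" "y' \<noteq> y" "x' < k" for y' x'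
    proof -
      have "jj y' < N" using assms by (auto simp: jj_def)
      then have "tr ! pos i (jj y') (step y' x' 0) = Kernel y' x'"
        "tr ! pos i (jj y') (step y' x' 1) = Pixel (i + y') (jj y' + x')"
        using that assms by (auto simp only: tr_kernel tr_pixel)
      then show "Kernel y' x' \<in> ?T" "Pixel (i + y') (jj y' + x') \<in> ?T"
        using imageI[OF in_range[OF that, of 0], of "(!) tr"]
          imageI[OF in_range[OF that, of 1], of "(!) tr"] by simp_all
    qed
    then show ?thesis by auto
  qed
  then have "card (?f ` ?I \<union> ?g ` ?I) \<le> card ?T" by (intro card_mono) auto
  also have "card (?f ` ?I \<union> ?g ` ?I) = card (?f ` ?I) + card (?g ` ?I)"
    by (intro card_Un_disjoint) auto
  also have "card (?f ` ?I) = (k - 1) * k"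
    using assms by (subst card_image) (auto simp: inj_on_def)
  also have "card (?g ` ?I) = (k - 1) * k"
    using assms by (subst card_image) (auto simp: inj_on_def)
  finally show ?thesis by (simp add: algebra_simps)
qed

text \<open>The first \<open>k - 1\<close> image rows of the window belong to both output rows.
  Columns left of \<open>j + k - 1\<close> have been visited by earlier bodies of row
  \<open>i\<close>; columns right of it, up to \<open>N - 1\<close>, by the bodies that end row
  \<open>i - 1\<close>. Only column \<open>j + k - 1\<close> is left out.\<close>

lemma card_vertical_ge:
  assumes "i < N" "j < N" "y < k" "x < k" "0 < i" "0 < j"
  shows "(k - 1) * (N - 1) \<le>
    card ((!) tr ` {pos (i - 1) (min (j + k - 1) (N - 1)) (P - 1)..pos i j (step y x 1)})"
proof -
  let ?m = "min (j + k - 1) (N - 1)"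
  let ?T = "(!) tr ` {pos (i - 1) ?m (P - 1)..pos i j (step y x 1)}"
  have q: "step y x 1 < P" using assms by (intro step_less_P) auto
  have "pixels {i..<i + (k - 1)} ({..<N} - {j + k - 1}) \<subseteq> ?T"
  proof
    fix d assume "d \<in> pixels {i..<i + (k - 1)} ({..<N} - {j + k - 1})"
    then obtain y' c where d: "d = Pixel (i + y') c" "y' < k - 1" "c < N" "c \<noteq> j + k - 1"
      by (auto simp: pixels_def) (metis add_less_cancel_left le_Suc_ex)
    show "d \<in> ?T"
    proof (cases "c < j + k - 1")
      case True
      \<comment> \<open>An output column before \<open>j\<close> whose window contains column
        \<open>c\<close>: it starts at \<open>c\<close> or, if \<open>c\<close> is further right, it
        is the preceding window.\<close>
      define j' where "j' = min c (j - 1)"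
      have j': "j' < j" "j' \<le> c" "c - j' < k" using True assms by (auto simp: j'_def)
      have q': "step y' (c - j') 1 < P" using j' d by (intro step_less_P) auto
      have "tr ! pos i j' (step y' (c - j') 1) = d"
        using j' d assms by (subst tr_pixel) auto
      moreover have "pos (i - 1) ?m (P - 1) < pos i j' (step y' (c - j') 1)"
        using assms j' q q' by (subst pos_less_iff) auto
      moreover have "pos i j' (step y' (c - j') 1) < pos i j (step y x 1)"
        using assms j' q q' by (subst pos_less_iff) auto
      ultimately show ?thesis by (intro image_eqI[of _ _ "pos i j' (step y' (c - j') 1)"]) simp_all
    next
      case False
      \<comment> \<open>Column \<open>c\<close> is the left edge of the window of output column
        \<open>c\<close>, and in output row \<open>i - 1\<close> the pixel is one kernel row further
        down.\<close>
      have q': "step (Suc y') 0 1 < P" using d by (intro step_less_P) auto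
      have "tr ! pos (i - 1) c (step (Suc y') 0 1) = d"
        using d assms by (subst tr_pixel) auto
      moreover have "pos (i - 1) ?m (P - 1) < pos (i - 1) c (step (Suc y') 0 1)"
        using assms False d q q' by (subst pos_less_iff) auto
      moreover have "pos (i - 1) c (step (Suc y') 0 1) < pos i j (step y x 1)"
        using assms False d q q' by (subst pos_less_iff) auto
      ultimately show ?thesis by (intro image_eqI[of _ _ "pos (i - 1) c (step (Suc y') 0 1)"]) simp_all
    qed
  qed
  then have "card (pixels {i..<i + (k - 1)} ({..<N} - {j + k - 1})) \<le> card ?T"
    by (intro card_mono) auto
  moreover have "N - 1 \<le> card ({..<N} - {j + k - 1})"
    using card_Diff_subset[of "{j + k - 1}" "{..<N}"] by (cases "j + k - 1 < N") auto
  then have "(k - 1) * (N - 1) \<le> (k - 1) * card ({..<N} - {j + k - 1})"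
    by (rule mult_le_mono2)
  ultimately show ?thesis
    by (simp only: card_pixels card_atLeastLessThan add_diff_cancel_left')
qed

end

section \<open>Upper bounds for the cost of each reuse\<close>

locale convolution_layout = convolution +
  fixes b :: nat and addr :: "datum \<Rightarrow> nat"
  assumes b_pos: "1 \<le> b" and layout: "conv_layout n k addr"
begin

abbreviation cost :: "nat \<Rightarrow> real" where
  "cost t \<equiv> sqrt (real (reuse_distance (cache_blocks b addr) tr t))"

text \<open>Blocks met in two adjacent bodies: the kernel as one run, \<open>k\<close> runs of
  \<open>k + 1\<close> pixels, and three further data.\<close>

definition H :: real where
  "H = 2 * real k ^ 2 / real b + real k / real b + 2 * real k + 5"

text \<open>Blocks met in two adjacent output rows: \<open>k + 1\<close> image rows as one run, the
  kernel as another, and at most \<open>2 * n + 1\<close> for results and sum.\<close>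

definition V :: real where
  "V = (real k * real n + real n + real k ^ 2) / real b + 2 * real n + 5"

lemma H_nonneg: "0 \<le> H" and V_nonneg: "0 \<le> V"
  by (auto simp: H_def V_def)

lemma blocks_kernel_data: "real (cache_blocks b addr kernel_data) \<le> real k ^ 2 / real b + 2"
proof -
  obtain base where base: "\<And>y x. y < k \<Longrightarrow> x < k \<Longrightarrow> addr (Kernel y x) = base + y * k + x"
    using layout unfolding conv_layout_def row_major_def by blast
  have "addr ` kernel_data \<subseteq> {base..<base + k * k}"
  proof
    fix a assume "a \<in> addr ` kernel_data"
    then obtain y x where a: "a = base + y * k + x" "y < k" "x < k"
      using base by (auto simp: kernel_data_def)
    then show "a \<in> {base..<base + k * k}"
      using mult_le_mono1[of "Suc y" k k] by simp
  qed
  from cache_blocks_run_le[OF b_pos this] show ?thesis by (simp add: power2_eq_square)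
qed

lemma addr_Pixel:
  obtains base where "\<And>r c. r < n \<Longrightarrow> c < n \<Longrightarrow> addr (Pixel r c) = base + r * n + c"
  using layout by (auto simp: conv_layout_def row_major_def)

text \<open>Each row of the window is a run of its own, so the rounding loss is paid
  \<open>k\<close> times.\<close>

lemma blocks_window:
  assumes "r + k \<le> n" "c + l \<le> n"
  shows "real (cache_blocks b addr (pixels {r..<r + k} {c..<c + l})) \<le> real k * (real l / real b + 2)"
proof -
  obtain base where base: "\<And>r c. r < n \<Longrightarrow> c < n \<Longrightarrow> addr (Pixel r c) = base + r * n + c"
    using addr_Pixel by blast
  have "pixels {r..<r + k} {c..<c + l} = (\<Union>r'\<in>{r..<r + k}. Pixel r' ` {c..<c + l})"
    by (auto simp: pixels_def)
  then have "cache_blocks b addr (pixels {r..<r + k} {c..<c + l})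
      \<le> (\<Sum>r'\<in>{r..<r + k}. cache_blocks b addr (Pixel r' ` {c..<c + l}))"
    by (simp add: cache_blocks_UN_le)
  then have "real (cache_blocks b addr (pixels {r..<r + k} {c..<c + l}))
      \<le> (\<Sum>r'\<in>{r..<r + k}. real (cache_blocks b addr (Pixel r' ` {c..<c + l})))"
    by (metis of_nat_le_iff of_nat_sum)
  also have "\<dots> \<le> (\<Sum>r'\<in>{r..<r + k}. real l / real b + 2)"
  proof (rule sum_mono)
    fix r' assume r': "r' \<in> {r..<r + k}"
    have "addr ` (Pixel r' ` {c..<c + l}) \<subseteq> {base + r' * n + c..<(base + r' * n + c) + l}"
      using r' assms by (auto simp: base)
    from cache_blocks_run_le[OF b_pos this]
    show "real (cache_blocks b addr (Pixel r' ` {c..<c + l})) \<le> real l / real b + 2" .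
  qed
  finally show ?thesis by simp
qed

text \<open>Full image rows are contiguous in row-major order, so the rounding loss is paid only
  once.\<close>

lemma blocks_rows:
  assumes "r + l \<le> n"
  shows "real (cache_blocks b addr (pixels {r..<r + l} {..<n})) \<le> real l * real n / real b + 2"
proof -
  obtain base where base: "\<And>r c. r < n \<Longrightarrow> c < n \<Longrightarrow> addr (Pixel r c) = base + r * n + c"
    using addr_Pixel by blast
  have "addr ` pixels {r..<r + l} {..<n} \<subseteq> {base + r * n..<(base + r * n) + l * n}"
  proof
    fix a assume "a \<in> addr ` pixels {r..<r + l} {..<n}"
    then obtain r' c where a: "a = base + r' * n + c" "r \<le> r'" "r' < r + l" "c < n"
      using assms by (auto simp: pixels_def base)
    then show "a \<in> {base + r * n..<(base + r * n) + l * n}"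
      using mult_le_mono1[of "Suc r'" "r + l" n] mult_le_mono1[of r r' n]
      by (simp add: add_mult_distrib trans_le_add1)
  qed
  from cache_blocks_run_le[OF b_pos this] show ?thesis by simp
qed

lemma horizontal_cost_le:
  assumes "i < N" "j < N" "q < P" "0 < j"
    and "pos i (j - 1) 0 \<le> s" "s < pos i j q" "tr ! s = tr ! pos i j q"
  shows "cost (pos i j q) \<le> sqrt H"
proof -
  let ?R = "{Acc, Result i (j - 1), Result i j}"
  let ?W = "pixels {i..<i + k} {j - 1..<j + k}"
  have "reuse_distance (cache_blocks b addr) tr (pos i j q) \<le> cache_blocks b addr (?R \<union> kernel_data \<union> ?W)"
    by (rule reuse_distance_le[OF assms(6,7) data_horizontal[OF assms(1-5)]])
      (auto intro!: cache_blocks_mono)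
  also have "\<dots> \<le> cache_blocks b addr ?R + cache_blocks b addr kernel_data + cache_blocks b addr ?W"
    using cache_blocks_Un_le[of b addr "?R \<union> kernel_data" ?W]
      cache_blocks_Un_le[of b addr ?R kernel_data] by linarith
  finally have "real (reuse_distance (cache_blocks b addr) tr (pos i j q)) \<le>
      real (cache_blocks b addr ?R) + real (cache_blocks b addr kernel_data) + real (cache_blocks b addr ?W)"
    by linarith
  \<comment> \<open>Results and sum may be placed anywhere, so each is allowed a block of its
    own.\<close>
  moreover have "cache_blocks b addr ?R \<le> 3"
    by (rule order_trans[OF cache_blocks_le_card]) (auto simp: card_insert_if)
  moreover have "real (cache_blocks b addr ?W) \<le> real k * (real (k + 1) / real b + 2)"
    using blocks_window[of i "j - 1" "k + 1"] assms k_le by (auto simp: N_def)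
  ultimately have "real (reuse_distance (cache_blocks b addr) tr (pos i j q)) \<le>
      3 + (real k ^ 2 / real b + 2) + real k * (real (k + 1) / real b + 2)"
    using blocks_kernel_data by linarith
  also have "\<dots> = H"
    unfolding H_def using b_pos by (simp add: field_simps power2_eq_square)
  finally show ?thesis by simp
qed

lemma vertical_cost_le:
  assumes "i < N" "j < N" "q < P"
    and "pos (i - 1) 0 0 \<le> s" "s < pos i j q" "tr ! s = tr ! pos i j q"
  shows "cost (pos i j q) \<le> sqrt V"
proof -
  let ?R = "{Acc} \<union> (\<Union>i'\<in>{i - 1, i}. Result i' ` {..<N})"
  let ?W = "pixels {i - 1..<i + k} {..<n}"
  have "reuse_distance (cache_blocks b addr) tr (pos i j q) \<le> cache_blocks b addr (?R \<union> kernel_data \<union> ?W)"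
    by (rule reuse_distance_le[OF assms(5,6) data_vertical[OF assms(1-4)]])
      (auto intro!: cache_blocks_mono)
  also have "\<dots> \<le> cache_blocks b addr ?R + cache_blocks b addr kernel_data + cache_blocks b addr ?W"
    using cache_blocks_Un_le[of b addr "?R \<union> kernel_data" ?W]
      cache_blocks_Un_le[of b addr ?R kernel_data] by linarith
  finally have "real (reuse_distance (cache_blocks b addr) tr (pos i j q)) \<le>
      real (cache_blocks b addr ?R) + real (cache_blocks b addr kernel_data) + real (cache_blocks b addr ?W)"
    by linarith
  moreover have "real (cache_blocks b addr ?R) \<le> 1 + 2 * real n"
  proof -
    have "cache_blocks b addr ?R \<le> card ?R" by (rule cache_blocks_le_card) auto
    also have "\<dots> \<le> 1 + card (Result (i - 1) ` {..<N} \<union> Result i ` {..<N})"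
      by (rule order_trans[OF card_Un_le]) simp
    also have "card (Result (i - 1) ` {..<N} \<union> Result i ` {..<N}) \<le> N + N"
      by (rule order_trans[OF card_Un_le]) (intro add_mono order_trans[OF card_image_le]; simp)
    also have "N \<le> n" using k_pos by (simp add: N_def)
    finally show ?thesis by simp
  qed
  moreover have "real (cache_blocks b addr ?W) \<le> real (k + 1) * real n / real b + 2"
  proof (cases "i = 0")
    case True
    have "real (cache_blocks b addr ?W) \<le> real k * real n / real b + 2"
      using blocks_rows[of 0 k] True k_le by simp
    also have "\<dots> \<le> real (k + 1) * real n / real b + 2"
      by (intro add_right_mono divide_right_mono mult_right_mono) auto
    finally show ?thesis .
  next
    case False
    then show ?thesis using blocks_rows[of "i - 1" "k + 1"] assms k_le by (auto simp: N_def)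
  qed
  ultimately have "real (reuse_distance (cache_blocks b addr) tr (pos i j q)) \<le>
      (1 + 2 * real n) + (real k ^ 2 / real b + 2) + (real (k + 1) * real n / real b + 2)"
    using blocks_kernel_data by linarith
  also have "\<dots> = V"
    unfolding V_def using b_pos by (simp add: field_simps power2_eq_square)
  finally show ?thesis by simp
qed

lemma Acc_cost_le:
  assumes "is_reuse tr t" "tr ! t = Acc"
  shows "cost t \<le> 2"
proof -
  obtain s where s: "s < t" "t \<le> s + 3" "tr ! s = Acc" using reuse_Acc[OF assms] by auto
  have "cache_blocks b addr B \<le> 4" if "B \<subseteq> (!) tr ` {s..t}" for B
  proof -
    have "cache_blocks b addr B \<le> cache_blocks b addr ((!) tr ` {s..t})"
      using that by (intro cache_blocks_mono) auto
    also have "\<dots> \<le> card ((!) tr ` {s..t})" by (rule cache_blocks_le_card) auto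
    also have "\<dots> \<le> card {s..t}" by (rule card_image_le) auto
    also have "\<dots> \<le> 4" using s by auto
    finally show ?thesis .
  qed
  with s assms(2) have "reuse_distance (cache_blocks b addr) tr t \<le> 4"
    by (intro reuse_distance_le[OF s(1) _ subset_refl]) auto
  then have "real (reuse_distance (cache_blocks b addr) tr t) \<le> 4" by linarith
  then have "cost t \<le> sqrt 4" by (simp only: real_sqrt_le_iff)
  then show ?thesis by simp
qed

text \<open>
  \<open>near\<close> and \<open>far\<close> overlap and also contain first accesses; only upper bounds on their
  cardinalities matter.
\<close>

definition near :: "nat set" where
  "near = (\<lambda>(i, j, y, x, c). pos i j (step y x c)) ` ({..<N} \<times> {..<N} \<times> {..<k} \<times> {..<k} \<times> {0, 1})"

definition far :: "nat set" where
  "far = (\<lambda>(i, j, y, x, c). pos i j (step y x c)) `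
     ({..<N} \<times> {0} \<times> {..<k} \<times> {..<k} \<times> {0, 1} \<union> {..<N} \<times> {..<N} \<times> {..<k} \<times> {k - 1} \<times> {1})"

lemma near_far_finite [simp]: "finite near" "finite far"
  by (auto simp: near_def far_def)

lemma nearI:
  "\<lbrakk>i < N; j < N; y < k; x < k; c = 0 \<or> c = 1\<rbrakk> \<Longrightarrow> pos i j (step y x c) \<in> near"
  unfolding near_def by (rule image_eqI[of _ _ "(i, j, y, x, c)"]) auto

lemma farI:
  "\<lbrakk>i < N; j < N; y < k; x < k; j = 0 \<and> (c = 0 \<or> c = 1) \<or> x = k - 1 \<and> c = 1\<rbrakk>
    \<Longrightarrow> pos i j (step y x c) \<in> far"
  unfolding far_def by (rule image_eqI[of _ _ "(i, j, y, x, c)"]) auto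

lemma card_near: "card near \<le> 2 * N ^ 2 * k ^ 2"
  unfolding near_def
  by (rule order_trans[OF card_image_le]) (auto simp: card_cartesian_product power2_eq_square)

text \<open>The accesses at \<open>j = 0\<close> give the first summand; relative to the second it
  is of order \<open>k / n\<close> and vanishes in the limit.\<close>

lemma card_far: "card far \<le> 2 * N * k ^ 2 + N ^ 2 * k"
  unfolding far_def
  by (rule order_trans[OF card_image_le]; (rule order_trans[OF card_Un_le])?)
    (auto simp: card_cartesian_product power2_eq_square)

lemma cost_cases:
  assumes "is_reuse tr t"
  shows "cost t \<le> 2 \<or> t \<in> near \<and> cost t \<le> sqrt H \<or> t \<in> far \<and> cost t \<le> sqrt V"
proof -
  obtain s where s: "s < t" "tr ! s = tr ! t" and len: "t < length tr"
    using assms(1) by (auto simp: is_reuse_def)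
  from len obtain i j q where t: "i < N" "j < N" "q < P" "t = pos i j q" by (rule pos_cases)
  have slen: "s < length tr" using s len by simp
  show ?thesis
  proof (cases "tr ! t")
    case Acc
    with Acc_cost_le assms show ?thesis by blast
  next
    case (Result r c)
    with s result_position[OF len Result] result_position[OF slen] show ?thesis by simp
  next
    case (Kernel y x)
    from len Kernel obtain i j where t: "i < N" "j < N" "y < k" "x < k" "t = pos i j (step y x 0)"
      by (rule kernel_positions)
    have q: "step y x 0 < P" using t by (intro step_less_P) auto
    show ?thesis
    proof (cases "j = 0")
      case False
      have "pos i (j - 1) 0 \<le> pos i (j - 1) (step y x 0)" by (simp add: pos_def)
      with horizontal_cost_le[OF t(1,2) q, of "pos i (j - 1) (step y x 0)"]
        kernel_reuse[OF t(1-4)] False t have "cost t \<le> sqrt H" by simp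
      moreover have "t \<in> near" unfolding t(5) using t by (intro nearI) auto
      ultimately show ?thesis by blast
    next
      \<comment> \<open>At the start of an output row the earlier access must come from a row above,
        so \<open>i > 0\<close>. The access in body (i - 1, 0) is then available; being earlier
        suffices for an upper bound, even if it is not the latest.\<close>
      case True
      have N: "0 < N" using t by simp
      from s Kernel have "tr ! s = Kernel y x" by simp
      with slen obtain i' j' where s': "i' < N" "j' < N" "s = pos i' j' (step y x 0)"
        by (rule kernel_positions)
      have "i' < i" using s(1) s' t q True by (auto simp: pos_less_iff)
      then have i: "i - 1 < N" "i - 1 < i" using t by auto
      have "cost t \<le> sqrt V" unfolding t(5)
      proof (rule vertical_cost_le[OF t(1,2) q])
        show "pos (i - 1) 0 0 \<le> pos (i - 1) 0 (step y x 0)" by (simp add: pos_def)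
        show "pos (i - 1) 0 (step y x 0) < pos i j (step y x 0)"
          using i t q N by (simp add: pos_less_iff)
        show "tr ! pos (i - 1) 0 (step y x 0) = tr ! pos i j (step y x 0)"
          using i t N by (simp add: tr_kernel)
      qed
      moreover have "t \<in> far" unfolding t(5) using t True by (intro farI) auto
      ultimately show ?thesis by blast
    qed
  next
    case (Pixel r c)
    from len Pixel obtain i j y x where t: "i < N" "j < N" "y < k" "x < k" "i + y = r" "j + x = c"
      "t = pos i j (step y x 1)" by (rule pixel_positions)
    have q: "step y x 1 < P" using t by (intro step_less_P) auto
    show ?thesis
    proof (cases "0 < j \<and> Suc x < k")
      case True
      have "pos i (j - 1) 0 \<le> pos i (j - 1) (step y (Suc x) 1)" by (simp add: pos_def)
      with horizontal_cost_le[OF t(1,2) q, of "pos i (j - 1) (step y (Suc x) 1)"]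
        horizontal_reuse[OF t(1-3)] True t have "cost t \<le> sqrt H" by simp
      moreover have "t \<in> near" unfolding t(7) using t by (intro nearI) auto
      ultimately show ?thesis by blast
    next
      case False
      from s Pixel have "tr ! s = Pixel r c" by simp
      with slen obtain i' j' y' x' where s': "i' < N" "j' < N" "y' < k" "x' < k"
        "i' + y' = r" "j' + x' = c" "s = pos i' j' (step y' x' 1)" by (rule pixel_positions)
      have q': "step y' x' 1 < P" using s' by (intro step_less_P) auto
      have N: "0 < N" "0 < P" using t q by auto
      have "cost t \<le> sqrt V"
      proof (cases "i' < i")
        case True
        \<comment> \<open>An earlier output row also used this image row, so it is not the last row
          of the window; hence the window of (i - 1, j) contains the pixel too.\<close>
        then have y: "Suc y < k" using s' t by linarith
        have i: "i - 1 < N" "i - 1 < i" "i - 1 + Suc y = r" using True t by auto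
        show ?thesis unfolding t(7)
        proof (rule vertical_cost_le[OF t(1,2) q])
          show "pos (i - 1) 0 0 \<le> pos (i - 1) j (step (Suc y) x 1)" by (simp add: pos_def add_mult_distrib)
          show "pos (i - 1) j (step (Suc y) x 1) < pos i j (step y x 1)"
            using i t q y step_less_P[of "Suc y" x 1] by (simp add: pos_less_iff)
          show "tr ! pos (i - 1) j (step (Suc y) x 1) = tr ! pos i j (step y x 1)"
            using i t y by (subst (1 2) tr_pixel) auto
        qed
      next
        case False
        \<comment> \<open>Here \<open>s\<close> lies in row \<open>i\<close> itself and can serve
          directly as the earlier access.\<close>
        then have "\<not> s < pos (i - 1) 0 0"
          using s' t q' N by (auto simp: pos_less_iff)
        then show ?thesis unfolding t(7)
          using s t by (intro vertical_cost_le[OF t(1,2) q, of s]) auto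
      qed
      moreover have "t \<in> far"
      proof -
        have "j = 0 \<or> x = k - 1" using False t by auto
        then show ?thesis unfolding t(7) using t by (intro farI) auto
      qed
      ultimately show ?thesis by blast
    qed
  qed
qed

section \<open>Summation of the costs\<close>

lemma dmc_le:
  "conv_block_dmc b addr n k \<le> 2 * real n ^ 2 * (4 * real k ^ 2 + 3)
     + 2 * real n ^ 2 * real k ^ 2 * sqrt H + (2 * real n * real k ^ 2 + real n ^ 2 * real k) * sqrt V"
proof -
  let ?R = "{t. is_reuse tr t}"
  have sub: "?R \<subseteq> {..<length tr}" by (auto simp: is_reuse_def)
  then have fin: "finite ?R" by (rule finite_subset) simp
  have Nn: "real N \<le> real n" using k_pos by (simp add: N_def)
  \<comment> \<open>Adding the three alternatives instead of choosing one allows the classes to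
    overlap; the constant 2 is charged to every reuse.\<close>
  have bound: "cost t \<le> 2 + of_bool (t \<in> near) * sqrt H + of_bool (t \<in> far) * sqrt V"
    if "t \<in> ?R" for t
  proof -
    have "is_reuse tr t" using that by simp
    from cost_cases[OF this] show ?thesis
    proof (elim disjE conjE)
      assume "cost t \<le> 2" then show ?thesis
        using H_nonneg V_nonneg by (simp add: add_increasing2)
    next
      assume "t \<in> near" "cost t \<le> sqrt H"
      moreover have "0 \<le> of_bool (t \<in> far) * sqrt V" using V_nonneg by simp
      moreover have "of_bool (t \<in> near) = (1::real)" using \<open>t \<in> near\<close> by simp
      ultimately show ?thesis by (simp only: mult_1)
    next
      assume "t \<in> far" "cost t \<le> sqrt V"
      moreover have "0 \<le> of_bool (t \<in> near) * sqrt H" using H_nonneg by simp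
      ultimately show ?thesis by (simp only: of_bool_eq)
    qed
  qed
  have ind: "(\<Sum>t\<in>?R. of_bool (t \<in> A) * c) \<le> real m * c"
    if "finite A" "card A \<le> m" "0 \<le> c" for A m and c :: real
  proof -
    have "(\<Sum>t\<in>?R. of_bool (t \<in> A) * c) = real (card (?R \<inter> A)) * c"
      using fin by (simp add: sum_distrib_right[symmetric] of_bool_def sum.If_cases)
    also have "\<dots> \<le> real m * c"
      using that card_mono[of A "?R \<inter> A"] by (intro mult_right_mono) auto
    finally show ?thesis .
  qed
  have "conv_block_dmc b addr n k = (\<Sum>t\<in>?R. cost t)"
    by (simp add: conv_block_dmc_def dmc_def)
  also have "\<dots> \<le> (\<Sum>t\<in>?R. 2 + of_bool (t \<in> near) * sqrt H + of_bool (t \<in> far) * sqrt V)"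
    by (intro sum_mono bound)
  also have "\<dots> = 2 * real (card ?R) + (\<Sum>t\<in>?R. of_bool (t \<in> near) * sqrt H)
      + (\<Sum>t\<in>?R. of_bool (t \<in> far) * sqrt V)"
    by (simp only: sum.distrib sum_constant)
  also have "\<dots> \<le> 2 * real (N * (N * P)) + real (2 * N ^ 2 * k ^ 2) * sqrt H
      + real (2 * N * k ^ 2 + N ^ 2 * k) * sqrt V"
  proof (intro add_mono mult_left_mono)
    show "real (card ?R) \<le> real (N * (N * P))"
      using card_mono[OF _ sub] unfolding length_tr by (simp del: of_nat_mult)
    show "(\<Sum>t\<in>?R. of_bool (t \<in> near) * sqrt H) \<le> real (2 * N ^ 2 * k ^ 2) * sqrt H"
      using H_nonneg by (intro ind card_near) auto
    show "(\<Sum>t\<in>?R. of_bool (t \<in> far) * sqrt V) \<le> real (2 * N * k ^ 2 + N ^ 2 * k) * sqrt V"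
      using V_nonneg by (intro ind card_far) auto
  qed auto
  also have "\<dots> = 2 * real N ^ 2 * (4 * real k ^ 2 + 3) + 2 * real N ^ 2 * real k ^ 2 * sqrt H
      + (2 * real N * real k ^ 2 + real N ^ 2 * real k) * sqrt V"
    by (simp add: P_def power2_eq_square algebra_simps)
  also have "\<dots> \<le> 2 * real n ^ 2 * (4 * real k ^ 2 + 3) + 2 * real n ^ 2 * real k ^ 2 * sqrt H
      + (2 * real n * real k ^ 2 + real n ^ 2 * real k) * sqrt V"
    using Nn H_nonneg V_nonneg by (intro add_mono mult_mono power_mono) auto
  finally show ?thesis .
qed

text \<open>Lets costs be summed over index tuples in the lower bound without counting an access
  twice.\<close>

lemma inj_pos_step:
  "inj_on (\<lambda>(i, j, y, x, c). pos i j (step y x c)) (UNIV \<times> {..<N} \<times> {..<k} \<times> {..<k} \<times> {..<4})"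
proof (rule inj_onI, clarsimp)
  fix i j y x c i' j' y' x' c'
  assume *: "pos i j (step y x c) = pos i' j' (step y' x' c')"
    "j < N" "y < k" "x < k" "c < 4" "j' < N" "y' < k" "x' < k" "c' < 4"
  have "i = i' \<and> j = j' \<and> step y x c = step y' x' c'"
    using * pos_eq_iff[OF *(2,6) step_less_P[OF *(3-5)] step_less_P[OF *(7-9)]] by simp
  then show "i = i' \<and> j = j' \<and> y = y' \<and> x = x' \<and> c = c'"
    using step_eq_iff[OF *(4,8,5,9)] by simp
qed

lemma cost_ge:
  assumes "is_reuse tr t" "\<And>s. s < t \<Longrightarrow> tr ! s = tr ! t \<Longrightarrow> s \<le> s0"
    and "m \<le> card ((!) tr ` {s0..t})"
  shows "sqrt (real m / real b) \<le> cost t"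
proof -
  let ?D = "data_since_previous tr t"
  have t: "t < length tr" using assms by (simp add: is_reuse_def)
  have D: "finite ?D" "?D \<subseteq> set tr"
    using t by (auto simp: data_since_previous_def)
  have "m \<le> card ?D"
    using assms(3) card_mono[OF D(1) data_since_previous_superset[OF assms(1,2)]] by simp
  then have "real m / real b \<le> real (card ?D) / real b" by (intro divide_right_mono) auto
  also have "\<dots> \<le> real (cache_blocks b addr ?D)"
    using layout D by (intro cache_blocks_ge b_pos) (auto simp: conv_layout_def intro: inj_on_subset)
  finally show ?thesis by (simp add: reuse_distance_def)
qed

text \<open>Dropping \<open>i = 0\<close> and \<open>j = 0\<close> leaves \<open>(n - k)^2\<close>
  bodies. In each, \<open>k * k\<close> kernel elements and \<open>k * (k - 1)\<close> pixels
  outside the rightmost column are reused horizontally, and \<open>k - 1\<close> pixels of that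
  column vertically.\<close>

lemma dmc_ge:
  "conv_block_dmc b addr n k \<ge>
    (real n - real k) ^ 2 * (real k * (2 * real k - 1)) * sqrt (2 * real k * (real k - 1) / real b)
    + (real n - real k) ^ 2 * (real k - 1) * sqrt ((real k - 1) * (real n - real k) / real b)"
proof -
  let ?p = "\<lambda>(i, j, y, x, c). pos i j (step y x c)"
  let ?IK = "{1..<N} \<times> {1..<N} \<times> {..<k} \<times> {..<k} \<times> {0::nat}"
  let ?IH = "{1..<N} \<times> {1..<N} \<times> {..<k} \<times> {..<k - 1} \<times> {1::nat}"
  let ?IV = "{1..<N} \<times> {1..<N} \<times> {..<k - 1} \<times> {k - 1} \<times> {1::nat}"
  let ?h = "sqrt (real (2 * k * (k - 1)) / real b)"
  let ?v = "sqrt (real ((k - 1) * (N - 1)) / real b)"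
  have fin: "finite {t. is_reuse tr t}"
    by (rule finite_subset[of _ "{..<length tr}"]) (auto simp: is_reuse_def)
  have horizontal: "is_reuse tr (?p u) \<and> ?h \<le> cost (?p u)" if u: "u \<in> ?IK \<union> ?IH" for u
  proof -
    obtain i j y x c where u_eq: "u = (i, j, y, x, c)" by (cases u) auto
    have ij: "i < N" "j < N" "y < k" "x < k" "0 < j" using u by (auto simp: u_eq)
    have Suc: "pos i (j - 1) (step y x' c') < pos i (j - 1) (step (Suc y) 0 0)" if "x' < k" "c' < 4" for x' c'
      using that step_less_iff[of x' 0 c' 0 y "Suc y"] k_pos by (simp add: pos_def)
    consider "c = 0" | "c = 1" "Suc x < k" using u by (auto simp: u_eq)
    then show ?thesis
    proof cases
      case 1
      note r = kernel_reuse[OF ij]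
      have "?h \<le> cost (pos i j (step y x 0))"
        using ij Suc[of x 0] by (intro cost_ge[OF r(3,4)] card_horizontal_ge) auto
      with r(3) show ?thesis unfolding u_eq prod.case 1 by simp
    next
      case 2
      note r = horizontal_reuse[OF ij(1-3) 2(2) ij(5)]
      have "?h \<le> cost (pos i j (step y x 1))"
        using ij Suc[of "Suc x" 1] 2 by (intro cost_ge[OF r(3,4)] card_horizontal_ge) auto
      with r(3) show ?thesis unfolding u_eq prod.case 2(1) by simp
    qed
  qed
  have vertical: "is_reuse tr (?p u) \<and> ?v \<le> cost (?p u)" if u: "u \<in> ?IV" for u
  proof -
    obtain i j y where u_eq: "u = (i, j, y, k - 1, 1)" using u by auto
    have ij: "i < N" "j < N" "Suc y < k" "0 < i" "0 < j" "y < k" "k - 1 < k" using u by (auto simp: u_eq)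
    note r = vertical_reuse[OF ij(1-4)]
    show ?thesis unfolding u_eq prod.case
      by (intro conjI r(1) cost_ge[OF r card_vertical_ge[OF ij(1,2,6,7,4,5)]])
  qed
  have inj: "inj_on ?p (?IK \<union> ?IH \<union> ?IV)"
    by (rule inj_on_subset[OF inj_pos_step]) auto
  have "card (?IK \<union> ?IH) = card ?IK + card ?IH" by (intro card_Un_disjoint) auto
  also have "\<dots> = (N - 1) ^ 2 * (k * k + k * (k - 1))"
    by (simp add: card_cartesian_product power2_eq_square add_mult_distrib2)
  finally have cardH: "card (?IK \<union> ?IH) = (N - 1) ^ 2 * (k * k + k * (k - 1))" .
  have cardV: "card ?IV = (N - 1) ^ 2 * (k - 1)"
    by (simp add: card_cartesian_product power2_eq_square)
  have "real (card (?IK \<union> ?IH)) * ?h + real (card ?IV) * ?v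
      \<le> (\<Sum>u\<in>?IK \<union> ?IH. cost (?p u)) + (\<Sum>u\<in>?IV. cost (?p u))"
    by (intro add_mono sum_bounded_below conjunct2[OF horizontal] conjunct2[OF vertical])
  also have "\<dots> = (\<Sum>u\<in>?IK \<union> ?IH \<union> ?IV. cost (?p u))"
    by (rule sum.union_disjoint[symmetric]) auto
  also have "\<dots> = (\<Sum>t\<in>?p ` (?IK \<union> ?IH \<union> ?IV). cost t)"
    by (simp only: sum.reindex[OF inj] o_def)
  also have "\<dots> \<le> (\<Sum>t | is_reuse tr t. cost t)"
  \<comment> \<open>The reuses outside the three index sets have nonnegative cost and are
    discarded.\<close>
  proof (intro sum_mono2 fin)
    show "?p ` (?IK \<union> ?IH \<union> ?IV) \<subseteq> {t. is_reuse tr t}"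
    proof (rule image_subsetI)
      fix u assume "u \<in> ?IK \<union> ?IH \<union> ?IV"
      then have "is_reuse tr (?p u)" using horizontal[of u] vertical[of u] by blast
      then show "?p u \<in> {t. is_reuse tr t}" by (rule CollectI)
    qed
  qed simp
  also have "\<dots> = conv_block_dmc b addr n k"
    by (simp add: conv_block_dmc_def dmc_def)
  finally have "real ((N - 1) ^ 2 * (k * k + k * (k - 1))) * ?h + real ((N - 1) ^ 2 * (k - 1)) * ?v
      \<le> conv_block_dmc b addr n k"
    unfolding cardH cardV .
  moreover have "N - 1 = n - k" by (simp add: N_def)
  moreover have "real (n - k) = real n - real k" "real (k - 1) = real k - 1"
    using k_le k_pos by (auto simp: of_nat_diff)
  moreover have "real k * real k + real k * (real k - 1) = real k * (2 * real k - 1)"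
    by (simp add: algebra_simps)
  ultimately show ?thesis
    by (simp only: of_nat_mult of_nat_add of_nat_power of_nat_numeral)
qed

end


section \<open>Asymptotics: correction factors and the limit\<close>

text \<open>The form in which the second term arises: \<open>x ^ 2 * y\<close> accesses of cost
  \<open>sqrt (x * y)\<close>.\<close>

lemma powr_terms_eq:
  fixes x y :: real
  assumes "0 < x" "0 < y"
  shows "x powr (5/2) * y powr (3/2) = x ^ 2 * y * sqrt (x * y)"
proof -
  have "x powr (5/2) = x powr (2 + 1/2)" "y powr (3/2) = y powr (1 + 1/2)" by simp_all
  then have "x powr (5/2) = x ^ 2 * sqrt x" "y powr (3/2) = y * sqrt y"
    unfolding powr_add using assms by (simp_all add: powr_half_sqrt powr_numeral)
  then show ?thesis by (simp add: real_sqrt_mult)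
qed

text \<open>Splits each summand into its main term and a factor that depends only on the small
  quantities \<open>u\<close> and \<open>v\<close> and is 1 at \<open>u = v = 0\<close>.\<close>

lemma lower_bound_factored:
  fixes x y \<beta> :: real
  assumes "0 < x" "1 \<le> y" "y \<le> x" "0 < \<beta>"
  defines "u \<equiv> 1 / y" and "v \<equiv> y / x"
  shows "(x - y) ^ 2 * (y * (2 * y - 1)) * sqrt (2 * y * (y - 1) / \<beta>)
      + (x - y) ^ 2 * (y - 1) * sqrt ((y - 1) * (x - y) / \<beta>)
    = 1 / sqrt \<beta> * (2 * sqrt 2 * x ^ 2 * y ^ 3 * ((1 - v) ^ 2 * (1 - u / 2) * sqrt (1 - u))
      + x ^ 2 * y * sqrt (x * y) * ((1 - v) ^ 2 * (1 - u) * sqrt ((1 - u) * (1 - v))))"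
proof -
  have pos: "x \<noteq> 0" "y \<noteq> 0" "0 < y" using assms by auto
  have xy: "x - y = x * (1 - v)" "y - 1 = y * (1 - u)" "2 * y - 1 = 2 * y * (1 - u / 2)"
    unfolding u_def v_def using pos by (simp_all add: field_simps)
  have "2 * y * (y - 1) / \<beta> = 2 * y ^ 2 * (1 - u) / \<beta>"
    unfolding xy by (simp add: power2_eq_square)
  then have "sqrt (2 * y * (y - 1) / \<beta>) = sqrt (2 * y ^ 2 * (1 - u) / \<beta>)" by (rule arg_cong)
  also have "\<dots> = sqrt 2 * y * sqrt (1 - u) / sqrt \<beta>"
    using pos by (simp add: real_sqrt_mult real_sqrt_divide)
  finally have 1: "sqrt (2 * y * (y - 1) / \<beta>) = sqrt 2 * y * sqrt (1 - u) / sqrt \<beta>" .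
  have "(y - 1) * (x - y) / \<beta> = (x * y) * ((1 - u) * (1 - v)) / \<beta>"
    unfolding xy by simp
  then have 2: "sqrt ((y - 1) * (x - y) / \<beta>) = sqrt (x * y) * sqrt ((1 - u) * (1 - v)) / sqrt \<beta>"
    by (simp only: real_sqrt_mult real_sqrt_divide)
  show ?thesis unfolding 1 2 unfolding xy
    by (simp add: power2_eq_square power3_eq_cube algebra_simps add_divide_distrib diff_divide_distrib)
qed

lemma upper_bound_factored:
  fixes x y \<beta> :: real
  assumes "0 < x" "0 < y" "0 < \<beta>"
  defines "u \<equiv> 1 / y" and "v \<equiv> y / x"
  shows "2 * x ^ 2 * (4 * y ^ 2 + 3)
      + 2 * x ^ 2 * y ^ 2 * sqrt (2 * y ^ 2 / \<beta> + y / \<beta> + 2 * y + 5)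
      + (2 * x * y ^ 2 + x ^ 2 * y) * sqrt ((y * x + x + y ^ 2) / \<beta> + 2 * x + 5)
    = 1 / sqrt \<beta> * (2 * sqrt 2 * x ^ 2 * y ^ 3
        * (sqrt (1 + u / 2 + \<beta> * u + 5 / 2 * \<beta> * u ^ 2) + sqrt \<beta> * (4 * u + 3 * u ^ 3) / sqrt 2)
      + x ^ 2 * y * sqrt (x * y) * ((1 + 2 * v) * sqrt (1 + u + v + 2 * \<beta> * u + 5 * \<beta> * u ^ 2 * v)))"
proof -
  define h where "h = sqrt (1 + u / 2 + \<beta> * u + 5 / 2 * \<beta> * u ^ 2)"
  define w where "w = sqrt (1 + u + v + 2 * \<beta> * u + 5 * \<beta> * u ^ 2 * v)"
  have "2 * y ^ 2 / \<beta> + y / \<beta> + 2 * y + 5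
      = 2 * y ^ 2 * (1 + u / 2 + \<beta> * u + 5 / 2 * \<beta> * u ^ 2) / \<beta>"
    unfolding u_def using assms(1-3) by (simp add: field_simps power2_eq_square)
  then have 1: "sqrt (2 * y ^ 2 / \<beta> + y / \<beta> + 2 * y + 5) = sqrt 2 * y * h / sqrt \<beta>"
    unfolding h_def using assms(2) by (simp add: real_sqrt_mult real_sqrt_divide)
  have "(y * x + x + y ^ 2) / \<beta> + 2 * x + 5
      = x * y * (1 + u + v + 2 * \<beta> * u + 5 * \<beta> * u ^ 2 * v) / \<beta>"
    unfolding u_def v_def using assms(1-3) by (simp add: field_simps power2_eq_square)
  then have 2: "sqrt ((y * x + x + y ^ 2) / \<beta> + 2 * x + 5) = sqrt (x * y) * w / sqrt \<beta>"
    unfolding w_def by (simp only: real_sqrt_mult real_sqrt_divide)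
  \<comment> \<open>The flat charge of 2 per access is a factor of order \<open>u\<close> below the
    first main term and is absorbed into its correction.\<close>
  have 3: "2 * x ^ 2 * (4 * y ^ 2 + 3)
      = 1 / sqrt \<beta> * (2 * sqrt 2 * x ^ 2 * y ^ 3 * (sqrt \<beta> * (4 * u + 3 * u ^ 3) / sqrt 2))"
    unfolding u_def using assms(1-3) by (simp add: field_simps power2_eq_square power3_eq_cube)
  have 4: "2 * x * y ^ 2 + x ^ 2 * y = x ^ 2 * y * (1 + 2 * v)"
    unfolding v_def using assms(1-3) by (simp add: field_simps power2_eq_square)
  show ?thesis
    unfolding 1 2 3 4 unfolding h_def[symmetric] w_def[symmetric]
    by (simp add: power2_eq_square power3_eq_cube algebra_simps)
qed

text \<open>Along \<open>conv_limit\<close> both \<open>k\<close> and \<open>n / k\<close> tend to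
  infinity by construction; the small quantities are their reciprocals, and
  \<open>n / k \<ge> 1\<close> eventually gives \<open>k \<le> n\<close>.\<close>

lemma conv_limit_tendsto:
  shows "((\<lambda>(n, k). 1 / real k) \<longlongrightarrow> 0) conv_limit"
    and "((\<lambda>(n, k). real k / real n) \<longlongrightarrow> 0) conv_limit"
    and "\<forall>\<^sub>F (n, k) in conv_limit. 1 \<le> k \<and> k \<le> n"
proof -
  have k: "filterlim (\<lambda>(n, k). k) at_top conv_limit"
    unfolding conv_limit_def filterlim_iff_le_filtercomap by simp
  have r: "filterlim (\<lambda>(n, k). real n / real k) at_top conv_limit"
    unfolding conv_limit_def filterlim_iff_le_filtercomap by simp
  have "filterlim (\<lambda>p. real (case p of (n, k) \<Rightarrow> k)) at_top conv_limit"
    by (rule filterlim_compose[OF filterlim_real_sequentially k])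
  from tendsto_inverse_0_at_top[OF this]
  show "((\<lambda>(n, k). 1 / real k) \<longlongrightarrow> 0) conv_limit"
    by (simp add: case_prod_beta' inverse_eq_divide)
  from tendsto_inverse_0_at_top[OF r]
  show "((\<lambda>(n, k). real k / real n) \<longlongrightarrow> 0) conv_limit"
    by (simp add: case_prod_beta')
  have "\<forall>\<^sub>F p in conv_limit. 1 \<le> (case p of (n, k) \<Rightarrow> k)"
    using k by (simp only: filterlim_at_top)
  moreover have "\<forall>\<^sub>F p in conv_limit. 1 \<le> (case p of (n, k) \<Rightarrow> real n / real k)"
    using r by (simp only: filterlim_at_top)
  ultimately show "\<forall>\<^sub>F (n, k) in conv_limit. 1 \<le> k \<and> k \<le> n"
    by eventually_elim (auto simp: le_divide_eq)
qed

theorem theorem3p20: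
  fixes b :: nat and addr :: "nat \<Rightarrow> nat \<Rightarrow> datum \<Rightarrow> nat"
  assumes "b \<ge> 1"
    and "\<And>n k. 1 \<le> k \<Longrightarrow> k \<le> n \<Longrightarrow> conv_layout n k (addr n k)"
  shows "(\<lambda>(n, k). conv_block_dmc b (addr n k) n k)
           \<sim>[conv_limit]
         (\<lambda>(n, k). 1 / sqrt (real b) *
            (2 * sqrt 2 * real n ^ 2 * real k ^ 3
             + real n powr (5/2) * real k powr (3/2)))"
proof (rule asymp_equivI')
  define X where "X = (\<lambda>p::nat \<times> nat. 2 * sqrt 2 * real (fst p) ^ 2 * real (snd p) ^ 3)"
  define Y where "Y = (\<lambda>p::nat \<times> nat. real (fst p) ^ 2 * real (snd p) * sqrt (real (fst p) * real (snd p)))"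
  define D where "D = (\<lambda>p. conv_block_dmc b (addr (fst p) (snd p)) (fst p) (snd p))"
  define T where "T = (\<lambda>(n, k). 1 / sqrt (real b) *
            (2 * sqrt 2 * real n ^ 2 * real k ^ 3
             + real n powr (5/2) * real k powr (3/2)))"
  define u where "u = (\<lambda>p::nat \<times> nat. 1 / real (snd p))"
  define v where "v = (\<lambda>p::nat \<times> nat. real (snd p) / real (fst p))"
  \<comment> \<open>Either of \<open>X\<close> and \<open>Y\<close> may dominate. As both are
    positive, the ratio is squeezed between the smaller of the two lower correction factors and the
    larger of the two upper ones.\<close>
  define lo where "lo = (\<lambda>p. min ((1 - v p) ^ 2 * (1 - u p / 2) * sqrt (1 - u p))
    ((1 - v p) ^ 2 * (1 - u p) * sqrt ((1 - u p) * (1 - v p))))"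
  define hi where "hi = (\<lambda>p. max
    (sqrt (1 + u p / 2 + real b * u p + 5 / 2 * real b * u p ^ 2)
      + sqrt (real b) * (4 * u p + 3 * u p ^ 3) / sqrt 2)
    ((1 + 2 * v p) * sqrt (1 + u p + v p + 2 * real b * u p + 5 * real b * u p ^ 2 * v p)))"
  have uv: "(u \<longlongrightarrow> 0) conv_limit" "(v \<longlongrightarrow> 0) conv_limit"
    using conv_limit_tendsto(1,2) by (simp_all add: u_def v_def case_prod_beta')
  \<comment> \<open>The limit is written with \<open>u\<close> and \<open>v\<close> literally
    replaced by 0, the shape that the limit rules produce.\<close>
  have "(lo \<longlongrightarrow> min ((1 - 0) ^ 2 * (1 - 0 / 2) * sqrt (1 - 0))
      ((1 - 0) ^ 2 * (1 - 0) * sqrt ((1 - 0) * (1 - 0)))) conv_limit"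
    unfolding lo_def by (intro tendsto_intros uv) auto
  then have lo: "(lo \<longlongrightarrow> 1) conv_limit" by simp
  have "(hi \<longlongrightarrow> max (sqrt (1 + 0 / 2 + real b * 0 + 5 / 2 * real b * 0 ^ 2)
      + sqrt (real b) * (4 * 0 + 3 * 0 ^ 3) / sqrt 2)
    ((1 + 2 * 0) * sqrt (1 + 0 + 0 + 2 * real b * 0 + 5 * real b * 0 ^ 2 * 0))) conv_limit"
    unfolding hi_def by (intro tendsto_intros uv) auto
  then have hi: "(hi \<longlongrightarrow> 1) conv_limit" by simp
  have bounds: "lo (n, k) \<le> D (n, k) / T (n, k) \<and> D (n, k) / T (n, k) \<le> hi (n, k)"
    if "1 \<le> k \<and> k \<le> n" for n k
  proof -
    interpret convolution_layout n k b "addr n k"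
      using that assms by unfold_locales auto
    have nk: "0 < real n" "1 \<le> real k" "0 < real k" "real k \<le> real n" "0 < real b"
      using that assms(1) by auto
    have XY: "0 < X (n, k)" "0 < Y (n, k)" using nk by (auto simp: X_def Y_def)
    have T: "T (n, k) = 1 / sqrt (real b) * (X (n, k) + Y (n, k))"
      using nk by (simp add: T_def X_def Y_def powr_terms_eq)
    have Tpos: "0 < T (n, k)" unfolding T using XY nk by simp
    have D: "D (n, k) = conv_block_dmc b (addr n k) n k" by (simp add: D_def)
    have "lo (n, k) * T (n, k) = 1 / sqrt (real b) * (X (n, k) * lo (n, k) + Y (n, k) * lo (n, k))"
      unfolding T by (simp add: algebra_simps)
    also have "\<dots> \<le> D (n, k)"
      unfolding D
    proof (rule order_trans[OF _ dmc_ge])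
      show "1 / sqrt (real b) * (X (n, k) * lo (n, k) + Y (n, k) * lo (n, k)) \<le>
        (real n - real k) ^ 2 * (real k * (2 * real k - 1)) * sqrt (2 * real k * (real k - 1) / real b)
        + (real n - real k) ^ 2 * (real k - 1) * sqrt ((real k - 1) * (real n - real k) / real b)"
        unfolding lower_bound_factored[OF nk(1,2,4,5)]
        unfolding X_def Y_def lo_def u_def v_def fst_conv snd_conv
        by (intro mult_left_mono add_mono min.cobounded1 min.cobounded2) auto
    qed
    finally have 1: "lo (n, k) * T (n, k) \<le> D (n, k)" .
    have "D (n, k) \<le> 1 / sqrt (real b) * (X (n, k) * hi (n, k) + Y (n, k) * hi (n, k))"
      unfolding D
    proof (rule order_trans[OF dmc_le])
      show "2 * real n ^ 2 * (4 * real k ^ 2 + 3) + 2 * real n ^ 2 * real k ^ 2 * sqrt H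
          + (2 * real n * real k ^ 2 + real n ^ 2 * real k) * sqrt V
        \<le> 1 / sqrt (real b) * (X (n, k) * hi (n, k) + Y (n, k) * hi (n, k))"
        unfolding H_def V_def upper_bound_factored[OF nk(1,3,5)]
        unfolding X_def Y_def hi_def u_def v_def fst_conv snd_conv
        by (intro mult_left_mono add_mono max.cobounded1 max.cobounded2) auto
    qed
    also have "\<dots> = hi (n, k) * T (n, k)"
      unfolding T by (simp add: algebra_simps)
    finally have 2: "D (n, k) \<le> hi (n, k) * T (n, k)" .
    show ?thesis using 1 2 Tpos by (simp add: pos_le_divide_eq pos_divide_le_eq)
  qed
  have "((\<lambda>p. D p / T p) \<longlongrightarrow> 1) conv_limit"
  proof (rule tendsto_sandwich[OF _ _ lo hi])
    show "\<forall>\<^sub>F p in conv_limit. lo p \<le> D p / T p" "\<forall>\<^sub>F p in conv_limit. D p / T p \<le> hi p"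
      using conv_limit_tendsto(3) by (eventually_elim; use bounds in auto)+
  qed
  then show "((\<lambda>p. (case p of (n, k) \<Rightarrow> conv_block_dmc b (addr n k) n k) /
      (case p of (n, k) \<Rightarrow> 1 / sqrt (real b) *
            (2 * sqrt 2 * real n ^ 2 * real k ^ 3
             + real n powr (5/2) * real k powr (3/2)))) \<longlongrightarrow> 1) conv_limit"
    unfolding D_def T_def by (simp add: case_prod_beta')
qed

end
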